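(* Let $p$ be a prime. (i) If $p\equiv 1\pmod 3$, then $$\sum_{k=1}^{\lfloor 2p/3\rfloor}\binom{2k}{k}(-2)^k\equiv 0 \pmod{p^2}\qquad\text{and}\qquad \sum_{k=0}^{\lfloor 5p/6\rfloor}\frac{\binom{2k}{k}}{(-32)^k}\equiv\left(\frac{2}{p}\right)\pmod{p^2}.$$ (ii) If $p\equiv 1\pmod 5$, then $$\sum_{k=1}^{\lfloor 4p/5\rfloor}\binom{2k}{k}(-1)^k\equiv 0\pmod{p^2}\qquad\text{and}\qquad \sum_{k=1}^{\lfloor 7p/10\rfloor}\frac{\binom{2k}{k}}{(-16)^k}\equiv 0\pmod{p^2},$$ and $$\sum_{k=1}^{\lfloor 3p/5\rfloor}\binom{2k}{k}(-1)^k\equiv 0\pmod{p^2}\qquad\text{and}\qquad \sum_{k=1}^{\lfloor 9p/10\rfloor}\frac{\binom{2k}{k}}{(-16)^k}\equiv 0\pmod{p^2}.$$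
   Context: $\left(\frac{2}{p}\right)$ denotes the Legendre symbol. Congruences between rational numbers whose denominators are prime to $p$ are understood in the ring $\mathbb{Z}_p$ of $p$-adic integers: $a\equiv b\pmod{p^2}$ means $a-b\in p^2\mathbb{Z}_p$. *)

theory Defs
  imports "HOL-Number_Theory.Number_Theory"
begin

text \<open>
  The rational \<open>p\<close>-adic integers: \<open>\<rat> \<inter> \<int>\<^sub>p\<close> consists of the fractions whose
  reduced denominator is prime to \<open>p\<close>. The function \<open>quotient_of\<close> returns the reduced
  fraction with positive denominator.
\<close>

definition padic_integral :: "nat \<Rightarrow> rat \<Rightarrow> bool" where
  "padic_integral p r \<longleftrightarrow> coprime (snd (quotient_of r)) (int p)"

text \<open>
  For rational \<open>a\<close> and \<open>b\<close>, the condition \<open>a - b \<in> p\<^sup>n \<int>\<^sub>p\<close>. Since \<open>p\<^sup>n\<close> is a nonzero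
  rational, the cofactor in \<open>\<int>\<^sub>p\<close> is itself rational, so \<open>c\<close> may range over \<open>rat\<close>.
\<close>

definition padic_cong :: "nat \<Rightarrow> nat \<Rightarrow> rat \<Rightarrow> rat \<Rightarrow> bool" where
  "padic_cong p n a b \<longleftrightarrow> (\<exists>c. padic_integral p c \<and> a - b = of_nat p ^ n * c)"

end

theory Submission
  imports Defs "HOL-Computational_Algebra.Computational_Algebra"
begin

text \<open>
  Let \<open>y = (1 + 4 c x\<^sup>r)\<^bsup>1/2\<^esup>\<close>, so that \<open>1/y\<close> is the generating function of \<open>binom(2k, k) (-c)\<^sup>k\<close>
  in \<open>x\<^sup>r\<close>. For each sum there are a polynomial \<open>q\<close> of degree at most \<open>D\<close> and a scalar \<open>s\<close> with \<open>s\<^sup>2 = d\<close>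
  such that the product \<open>N = y\<^sup>2 - d q\<^sup>2\<close> of \<open>f = y + s q\<close> and its conjugate \<open>h = y - s q\<close> has the form
  \<open>n\<^sub>0 x\<^sup>a (1 - x\<^sup>b)\<^sup>e\<close>; these \<open>f\<close> come from torsion points on the curves \<open>y\<^sup>2 = 1 + 8 x\<^sup>3\<close> and
  \<open>y\<^sup>2 = 1 + 4 x\<^sup>5\<close>, expanded at \<open>x = 0\<close> or at infinity. The sum up to \<open>p j div r\<close> is, up to constants,
  the coefficient of \<open>x\<^sup>p\<^sup>j\<close> in the logarithmic derivative \<open>(x d/dx f) / f\<close>, so it suffices to compare it
  modulo \<open>p\<^sup>2\<close> with the coefficient of \<open>x\<^sup>j\<close> for \<open>F = y + \<epsilon> s q\<close>, where \<open>\<epsilon> = (d/p)\<close>. Write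
  \<open>f\<^sup>p = F(x\<^sup>p) (1 + g)\<close> with \<open>g\<close> divisible by \<open>p\<close>; the claim becomes that the coefficient of \<open>x\<^sup>p\<^sup>j\<close> in \<open>g\<close>
  vanishes modulo \<open>p\<^sup>2\<close>. Since \<open>f\<^sup>p - h\<^sup>p\<close> is a polynomial of degree less than \<open>(D + 1) p\<close> and the shape of
  \<open>N\<close> controls \<open>f\<^sup>p h\<^sup>p\<close>, the coefficients of \<open>g\<close> at multiples of \<open>p\<close> are, up to a constant term, those of
  \<open>B/y\<close> for a polynomial \<open>B\<close> of degree at most \<open>D\<close>. As \<open>1/y\<close> is a series in \<open>x\<^sup>r\<close>, they vanish for
  \<open>D < j < r\<close>.
\<close>

section \<open>Dilation, sections and Frobenius congruences of power series\<close>

definition fps_dilate :: "nat \<Rightarrow> 'a::field fps \<Rightarrow> 'a fps" where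
  "fps_dilate m f = f oo (fps_X ^ m)"

definition fps_section :: "nat \<Rightarrow> 'a::field fps \<Rightarrow> 'a fps" where
  "fps_section m f = Abs_fps (\<lambda>n. f $ (m * n))"

lemma fps_dilate_nth: "m > 0 \<Longrightarrow> fps_dilate m f $ n = (if m dvd n then f $ (n div m) else 0)"
  by (simp add: fps_dilate_def fps_nth_compose_X_power)

lemma fps_section_nth [simp]: "fps_section m f $ n = f $ (m * n)"
  by (simp add: fps_section_def)

lemma fps_dilate_simps:
  assumes "m > 0"
  shows "fps_dilate m (f + g) = fps_dilate m f + fps_dilate m g"
    and "fps_dilate m (f - g) = fps_dilate m f - fps_dilate m g"
    and "fps_dilate m (f * g) = fps_dilate m f * fps_dilate m g"
    and "fps_dilate m (f ^ k) = fps_dilate m f ^ k"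
    and "fps_dilate m (fps_const c) = fps_const c"
    and "fps_dilate m 1 = 1"
    and "fps_dilate m fps_X = fps_X ^ m"
  using assms
  by (simp_all add: fps_dilate_def fps_compose_add_distrib fps_compose_sub_distrib
      fps_compose_mult_distrib fps_compose_power)

lemma fps_section_simps:
  "fps_section m (f + g) = fps_section m f + fps_section m g"
  "fps_section m (f - g) = fps_section m f - fps_section m g"
  by (simp_all add: fps_eq_iff)

text \<open>If two indices add up to a multiple of m and the first is a multiple of m, so is the
  second. Sections are thus linear over series in x^m, which later pulls factors such as F(x^p)
  out.\<close>

lemma fps_section_dilate_mult:
  assumes "m > 0"
  shows "fps_section m (fps_dilate m f * g) = f * fps_section m g"
proof (rule fps_ext)
  fix n
  have "fps_section m (fps_dilate m f * g) $ n = (\<Sum>i=0..m*n. fps_dilate m f $ i * g $ (m*n - i))"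
    by (simp add: fps_mult_nth)
  also have "\<dots> = (\<Sum>i\<in>(\<lambda>i. m * i) ` {0..n}. fps_dilate m f $ i * g $ (m*n - i))"
    by (rule sum.mono_neutral_right) (use assms in \<open>auto simp: fps_dilate_nth elim!: dvdE\<close>)
  also have "\<dots> = (\<Sum>i=0..n. f $ i * g $ (m * (n - i)))"
    by (subst sum.reindex)
       (use assms in \<open>auto simp: fps_dilate_nth inj_on_def diff_mult_distrib2\<close>)
  also have "\<dots> = (f * fps_section m g) $ n"
    by (simp add: fps_mult_nth)
  finally show "fps_section m (fps_dilate m f * g) $ n = (f * fps_section m g) $ n" .
qed

lemma fps_section_dilate: "m > 0 \<Longrightarrow> fps_section m (fps_dilate m f) = f"
  by (simp add: fps_eq_iff fps_dilate_nth)

text \<open>The Euler operator acts diagonally on coefficients, so at an index divisible by p it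
  contributes a factor p.\<close>

definition fps_theta :: "'a::field fps \<Rightarrow> 'a fps" where
  "fps_theta f = fps_X * fps_deriv f"

lemma fps_theta_nth: "fps_theta f $ n = of_nat n * f $ n"
  by (cases n) (simp_all add: fps_theta_def)

lemma fps_theta_mult: "fps_theta (f * g) = fps_theta f * g + f * fps_theta g"
  by (simp add: fps_theta_def algebra_simps)

lemma fps_theta_power: "fps_theta (f ^ n) * f = of_nat n * fps_theta f * f ^ n"
  by (induction n) (simp_all add: fps_theta_mult algebra_simps, simp add: fps_theta_def)

lemma fps_theta_dilate: "m > 0 \<Longrightarrow> fps_theta (fps_dilate m f) = of_nat m * fps_dilate m (fps_theta f)"
  by (auto simp: fps_eq_iff fps_theta_nth fps_dilate_nth fps_of_nat[symmetric] elim!: dvdE)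

section \<open>Subrings of a field and their filtration by powers of p\<close>

locale local_subring =
  fixes p :: nat and R :: "'a::field_char_0 set"
  assumes prime_p: "prime p"
    and one_mem: "1 \<in> R"
    and diff_mem: "x \<in> R \<Longrightarrow> y \<in> R \<Longrightarrow> x - y \<in> R"
    and mult_mem: "x \<in> R \<Longrightarrow> y \<in> R \<Longrightarrow> x * y \<in> R"
begin

lemma p_pos: "p > 0" using prime_p prime_gt_0_nat by blast
lemma p_neq0 [simp]: "p \<noteq> 0" using p_pos by simp

lemma zero_mem: "0 \<in> R" using diff_mem[OF one_mem one_mem] by simp
lemma uminus_mem: "x \<in> R \<Longrightarrow> - x \<in> R" using diff_mem[OF zero_mem] by force
lemma add_mem: "x \<in> R \<Longrightarrow> y \<in> R \<Longrightarrow> x + y \<in> R" using diff_mem[of x "-y"] uminus_mem[of y] by simp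
lemma of_nat_mem: "of_nat n \<in> R" by (induction n) (auto intro: zero_mem one_mem add_mem)
lemma of_int_mem: "of_int n \<in> R" by (cases n rule: int_cases2) (auto intro: of_nat_mem uminus_mem)
lemma power_mem: "x \<in> R \<Longrightarrow> x ^ n \<in> R" by (induction n) (auto intro: one_mem mult_mem)
lemma sum_mem: "(\<And>i. i \<in> A \<Longrightarrow> f i \<in> R) \<Longrightarrow> sum f A \<in> R"
  by (induction A rule: infinite_finite_induct) (auto intro: zero_mem add_mem)

text \<open>The ideal p^k R, expressed by division in the ambient field so that cancelling p is
  immediate. The ring in mind is Z_(p)[sqrt d].\<close>

definition pideal :: "nat \<Rightarrow> 'a set" where
  "pideal k = {x. x / of_nat p ^ k \<in> R}"

lemma pideal_0 [simp]: "pideal 0 = R" by (simp add: pideal_def)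

lemma pideal_zero: "0 \<in> pideal k" by (simp add: pideal_def zero_mem)
lemma pideal_add: "x \<in> pideal k \<Longrightarrow> y \<in> pideal k \<Longrightarrow> x + y \<in> pideal k"
  by (simp add: pideal_def add_divide_distrib add_mem)
lemma pideal_diff: "x \<in> pideal k \<Longrightarrow> y \<in> pideal k \<Longrightarrow> x - y \<in> pideal k"
  by (simp add: pideal_def diff_divide_distrib diff_mem)
lemma pideal_mult: "x \<in> pideal j \<Longrightarrow> y \<in> pideal k \<Longrightarrow> x * y \<in> pideal (j + k)"
  using mult_mem[of "x / of_nat p ^ j" "y / of_nat p ^ k"] by (simp add: pideal_def power_add)
lemma pideal_sum: "(\<And>i. i \<in> A \<Longrightarrow> f i \<in> pideal k) \<Longrightarrow> sum f A \<in> pideal k"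
  by (induction A rule: infinite_finite_induct) (auto intro: pideal_zero pideal_add)
lemma pideal_p: "of_nat p \<in> pideal 1"
  by (simp add: pideal_def one_mem)
lemma pideal_dvd: "p dvd n \<Longrightarrow> of_nat n \<in> pideal 1"
  by (auto elim!: dvdE simp: pideal_def of_nat_mem)
lemma pideal_cancel_p: "of_nat p * x \<in> pideal (Suc k) \<Longrightarrow> x \<in> pideal k"
  by (simp add: pideal_def)
lemma pideal_mult_left: "x \<in> R \<Longrightarrow> y \<in> pideal k \<Longrightarrow> x * y \<in> pideal k"
  using pideal_mult[of x 0 y k] by simp
lemma pideal_antimono: "x \<in> pideal k \<Longrightarrow> j \<le> k \<Longrightarrow> x \<in> pideal j"
proof -
  assume x: "x \<in> pideal k" and "j \<le> k"
  then obtain d where k: "k = j + d" using le_Suc_ex by blast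
  have "x / of_nat p ^ j = of_nat p ^ d * (x / of_nat p ^ k)"
    by (simp add: k power_add)
  moreover have "of_nat p ^ d * (x / of_nat p ^ k) \<in> R"
    using x by (intro mult_mem power_mem of_nat_mem) (simp add: pideal_def)
  ultimately show ?thesis by (simp add: pideal_def)
qed

definition pseries :: "nat \<Rightarrow> 'a fps set" where
  "pseries k = {f. \<forall>n. f $ n \<in> pideal k}"

lemma pseriesI: "(\<And>n. f $ n \<in> pideal k) \<Longrightarrow> f \<in> pseries k" by (simp add: pseries_def)
lemma pseriesD: "f \<in> pseries k \<Longrightarrow> f $ n \<in> pideal k" by (simp add: pseries_def)

lemma pseries_zero: "0 \<in> pseries k" by (simp add: pseries_def pideal_zero)
lemma pseries_one: "1 \<in> pseries 0" by (simp add: pseries_def zero_mem one_mem)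
lemma pseries_X: "fps_X \<in> pseries 0" by (simp add: pseries_def fps_X_def zero_mem one_mem)
lemma pseries_const: "c \<in> pideal k \<Longrightarrow> fps_const c \<in> pseries k" by (simp add: pseries_def pideal_zero)
lemma pseries_add: "f \<in> pseries k \<Longrightarrow> g \<in> pseries k \<Longrightarrow> f + g \<in> pseries k"
  by (simp add: pseries_def pideal_add)
lemma pseries_diff: "f \<in> pseries k \<Longrightarrow> g \<in> pseries k \<Longrightarrow> f - g \<in> pseries k"
  by (simp add: pseries_def pideal_diff)
lemma pseries_uminus: "f \<in> pseries k \<Longrightarrow> - f \<in> pseries k"
  using pseries_diff[OF pseries_zero] by force
lemma pseries_mult: "f \<in> pseries j \<Longrightarrow> g \<in> pseries k \<Longrightarrow> f * g \<in> pseries (j + k)"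
  by (simp add: pseries_def fps_mult_nth pideal_sum pideal_mult)
lemma pseries_mult_left: "f \<in> pseries 0 \<Longrightarrow> g \<in> pseries k \<Longrightarrow> f * g \<in> pseries k"
  using pseries_mult[of f 0 g k] by simp
lemma pseries_mult_right: "f \<in> pseries k \<Longrightarrow> g \<in> pseries 0 \<Longrightarrow> f * g \<in> pseries k"
  using pseries_mult[of f k g 0] by simp
lemma pseries_power: "f \<in> pseries 0 \<Longrightarrow> f ^ n \<in> pseries 0"
  by (induction n) (auto intro: pseries_one pseries_mult_left)
lemma pseries_antimono: "f \<in> pseries k \<Longrightarrow> j \<le> k \<Longrightarrow> f \<in> pseries j"
  by (auto simp: pseries_def intro: pideal_antimono)
lemma pseries_sum: "(\<And>i. i \<in> A \<Longrightarrow> f i \<in> pseries k) \<Longrightarrow> sum f A \<in> pseries k"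
  by (induction A rule: infinite_finite_induct) (auto intro: pseries_zero pseries_add)
lemma pseries_section: "f \<in> pseries k \<Longrightarrow> fps_section m f \<in> pseries k"
  by (simp add: pseries_def)
lemma pseries_dilate: "f \<in> pseries k \<Longrightarrow> fps_dilate p f \<in> pseries k"
  by (simp add: pseries_def fps_dilate_nth p_pos pideal_zero)
lemma pseries_theta: "f \<in> pseries k \<Longrightarrow> fps_theta f \<in> pseries k"
  by (simp add: pseries_def fps_theta_nth pideal_mult_left of_nat_mem)

text \<open>Comparing coefficients in \<open>f * inverse f = 1\<close> expresses each coefficient of
  the inverse through earlier ones, dividing only by \<open>f $ 0\<close>.\<close>

lemma pseries_inverse:
  assumes f: "f \<in> pseries 0" and f0: "f $ 0 \<noteq> 0" "inverse (f $ 0) \<in> R"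
  shows "inverse f \<in> pseries 0"
proof (rule pseriesI)
  fix n show "inverse f $ n \<in> pideal 0"
  proof (induction n rule: less_induct)
    case (less n)
    show ?case
    proof (cases "n = 0")
      case False
      have "0 = (f * inverse f) $ n"
        using f0 False by (subst inverse_mult_eq_1') auto
      also have "\<dots> = f $ 0 * inverse f $ n + (\<Sum>i=1..n. f $ i * inverse f $ (n - i))"
        by (simp add: fps_mult_nth sum.atLeast_Suc_atMost)
      finally have "inverse f $ n = inverse (f $ 0) * (- (\<Sum>i=1..n. f $ i * inverse f $ (n - i)))"
        using f0 by (simp add: field_simps eq_neg_iff_add_eq_0)
      also have "\<dots> \<in> R"
        using less pseriesD[OF f] f0
        by (intro mult_mem uminus_mem sum_mem) auto
      finally show ?thesis by simp
    qed (use f0 in simp)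
  qed
qed

section \<open>Series commuting with Frobenius modulo p\<close>

lemma pseries_dream:
  assumes f: "f \<in> pseries 0" and g: "g \<in> pseries 0"
  shows "(f + g) ^ p - (f ^ p + g ^ p) \<in> pseries 1"
proof -
  have "(f + g) ^ p = (\<Sum>k\<le>p. of_nat (p choose k) * f ^ k * g ^ (p - k))"
    by (rule binomial_ring)
  also have "{..p} = insert 0 (insert p {0<..<p})" using p_pos by auto
  finally have "(f + g) ^ p - (f ^ p + g ^ p) =
      (\<Sum>k\<in>{0<..<p}. of_nat (p choose k) * f ^ k * g ^ (p - k))"
    by simp
  also have "\<dots> \<in> pseries 1"
  proof (rule pseries_sum)
    fix k assume "k \<in> {0<..<p}"
    then have "p dvd p choose k" using prime_p by (intro dvd_choose_prime) auto
    then have "of_nat (p choose k) \<in> pseries 1"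
      by (subst fps_of_nat[symmetric]) (intro pseries_const pideal_dvd)
    then show "of_nat (p choose k) * f ^ k * g ^ (p - k) \<in> pseries 1"
      by (intro pseries_mult_right pseries_power f g)
  qed
  finally show ?thesis .
qed

text \<open>On constants the condition is Fermat's congruence, which sqrt d satisfies only up to the
  sign (d/p). The scalar s is therefore kept apart and tracked by \<epsilon>.\<close>

definition frobenius_series :: "'a fps set" where
  "frobenius_series = {f \<in> pseries 0. f ^ p - fps_dilate p f \<in> pseries 1}"

lemma frobenius_add:
  assumes "f \<in> frobenius_series" "g \<in> frobenius_series"
  shows "f + g \<in> frobenius_series"
proof -
  have "(f + g) ^ p - fps_dilate p (f + g) = ((f + g) ^ p - (f ^ p + g ^ p)) +
      ((f ^ p - fps_dilate p f) + (g ^ p - fps_dilate p g))"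
    by (simp add: fps_dilate_simps p_pos)
  also have "\<dots> \<in> pseries 1"
    using assms unfolding frobenius_series_def by (intro pseries_add pseries_dream) auto
  finally show ?thesis using assms by (auto simp: frobenius_series_def pseries_add)
qed

lemma frobenius_mult:
  assumes "f \<in> frobenius_series" "g \<in> frobenius_series"
  shows "f * g \<in> frobenius_series"
proof -
  have "(f * g) ^ p - fps_dilate p (f * g) = (f ^ p - fps_dilate p f) * g ^ p +
      fps_dilate p f * (g ^ p - fps_dilate p g)"
    by (simp add: fps_dilate_simps p_pos algebra_simps power_mult_distrib)
  also have "\<dots> \<in> pseries 1"
    using assms unfolding frobenius_series_def
    by (intro pseries_add pseries_mult_left pseries_mult_right pseries_power pseries_dilate) auto
  finally show ?thesis using assms by (auto simp: frobenius_series_def pseries_mult_left)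
qed

lemma frobenius_const: "c \<in> R \<Longrightarrow> c ^ p - c \<in> pideal 1 \<Longrightarrow> fps_const c \<in> frobenius_series"
  by (auto simp: frobenius_series_def fps_dilate_simps p_pos fps_const_power intro!: pseries_const)

lemma frobenius_X: "fps_X \<in> frobenius_series"
  by (simp add: frobenius_series_def fps_dilate_simps p_pos pseries_X pseries_zero)

lemma frobenius_power: "f \<in> frobenius_series \<Longrightarrow> f ^ n \<in> frobenius_series"
proof (induction n)
  case 0
  then show ?case
    by (simp add: frobenius_series_def fps_dilate_simps p_pos pseries_one pseries_zero)
qed (simp add: frobenius_mult)

text \<open>A difference of squares: y^p - y(x^p) times y^p + y(x^p) is the defect of y^2, and the
  second factor has constant term 2, hence is invertible over R.\<close>

lemma frobenius_root:
  assumes y: "y \<in> pseries 0" "y $ 0 = 1" and sq: "y ^ 2 \<in> frobenius_series" and half: "1 / 2 \<in> R"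
  shows "y \<in> frobenius_series"
proof -
  let ?u = "y ^ p + fps_dilate p y"
  have u0: "?u $ 0 = 2" using y by (simp add: fps_dilate_nth p_pos fps_nth_power_0)
  have u: "?u \<in> pseries 0" by (intro pseries_add pseries_power pseries_dilate y)
  have iu: "inverse ?u \<in> pseries 0"
    by (rule pseries_inverse[OF u]) (use u0 half in \<open>simp_all add: field_simps\<close>)
  have "(y ^ p - fps_dilate p y) * ?u = (y ^ 2) ^ p - fps_dilate p (y ^ 2)"
    by (simp add: fps_dilate_simps p_pos algebra_simps power2_eq_square power_mult_distrib)
  then have "(y ^ p - fps_dilate p y) * ?u \<in> pseries 1"
    using sq by (simp add: frobenius_series_def)
  then have "((y ^ p - fps_dilate p y) * ?u) * inverse ?u \<in> pseries 1"
    using iu by (rule pseries_mult_right)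
  moreover have "?u * inverse ?u = 1" using u0 by (intro inverse_mult_eq_1') simp
  ultimately show ?thesis using y by (simp add: frobenius_series_def mult.assoc)
qed

text \<open>Closed under products because the scalars \<open>e\<close> add up; this is how norms that
  split into monomials and factors \<open>1 - x\<^sup>b\<close> are handled.\<close>

definition scalar_frobenius :: "'a fps set" where
  "scalar_frobenius = {f \<in> frobenius_series. \<exists>e\<in>pideal 1.
     fps_section p (f ^ p - fps_dilate p f) - fps_const e * f \<in> pseries 2}"

lemma scalar_frobenius_mult:
  assumes "f \<in> scalar_frobenius" "g \<in> scalar_frobenius"
  shows "f * g \<in> scalar_frobenius"
proof -
  define A B where "A = f ^ p - fps_dilate p f" and "B = g ^ p - fps_dilate p g"
  have f: "f \<in> frobenius_series" and g: "g \<in> frobenius_series"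
    using assms by (auto simp: scalar_frobenius_def)
  then have A: "A \<in> pseries 1" and B: "B \<in> pseries 1" and f0: "f \<in> pseries 0" and g0: "g \<in> pseries 0"
    by (auto simp: frobenius_series_def A_def B_def)
  obtain a b where a: "a \<in> pideal 1" "fps_section p A - fps_const a * f \<in> pseries 2"
    and b: "b \<in> pideal 1" "fps_section p B - fps_const b * g \<in> pseries 2"
    using assms by (auto simp: scalar_frobenius_def A_def B_def)
  \<comment> \<open>The summand \<open>A * B\<close> lies in p^2; the section pulls f and g out of
    the other two summands, so the scalars of f and g add.\<close>
  have "(f * g) ^ p - fps_dilate p (f * g) = fps_dilate p f * B + fps_dilate p g * A + A * B"
    by (simp add: fps_dilate_simps p_pos algebra_simps power_mult_distrib A_def B_def)
  then have "fps_section p ((f * g) ^ p - fps_dilate p (f * g)) =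
      f * fps_section p B + g * fps_section p A + fps_section p (A * B)"
    by (simp add: fps_section_simps fps_section_dilate_mult p_pos)
  then have "fps_section p ((f * g) ^ p - fps_dilate p (f * g)) - fps_const (a + b) * (f * g) =
      f * (fps_section p B - fps_const b * g) + g * (fps_section p A - fps_const a * f)
        + fps_section p (A * B)"
    by (simp add: algebra_simps flip: fps_const_add)
  also have "\<dots> \<in> pseries 2"
    using pseries_section[OF pseries_mult[OF A B]]
    by (intro pseries_add pseries_mult_left a b f0 g0) (simp add: numeral_2_eq_2)
  finally show ?thesis
    using frobenius_mult[OF f g] pideal_add[OF a(1) b(1)] by (auto simp: scalar_frobenius_def)
qed

lemma scalar_frobenius_const:
  assumes "c \<in> R" "inverse c \<in> R" "c \<noteq> 0" "c ^ p - c \<in> pideal 1"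
  shows "fps_const c \<in> scalar_frobenius"
proof -
  have "(c ^ p - c) * inverse c \<in> pideal 1"
    using assms pideal_mult_left[of "inverse c" "c ^ p - c"] by (simp add: mult.commute)
  moreover have "fps_section p (fps_const c ^ p - fps_dilate p (fps_const c))
      - fps_const ((c ^ p - c) * inverse c) * fps_const c = 0"
    using assms(3) p_pos by (simp add: fps_eq_iff fps_const_power fps_dilate_simps)
  ultimately show ?thesis
    using frobenius_const[OF assms(1,4)] pseries_zero[of 2]
    unfolding scalar_frobenius_def by (metis (mono_tags, lifting) mem_Collect_eq)
qed

lemma scalar_frobenius_X: "fps_X \<in> scalar_frobenius"
  using frobenius_X pideal_zero[of 1] pseries_zero[of 2]
  by (auto simp: scalar_frobenius_def fps_dilate_simps p_pos fps_section_simps intro!: bexI[of _ 0])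

lemma scalar_frobenius_power: "n > 0 \<Longrightarrow> f \<in> scalar_frobenius \<Longrightarrow> f ^ n \<in> scalar_frobenius"
  by (induction n rule: nat_induct_non_zero) (auto intro: scalar_frobenius_mult)

text \<open>In the p-th power the terms with 0 < k < p sit at exponents b k, never multiples of p
  since b is prime to p. The section of the defect is exactly zero, so e = 0 works.\<close>

lemma scalar_frobenius_one_minus_X_power:
  assumes "odd p" "coprime b p" "b > 0"
  shows "1 - fps_X ^ b \<in> scalar_frobenius"
proof -
  have m1: "(-1 :: 'a) ^ p - (-1) \<in> pideal 1" using assms(1) by (simp add: pideal_zero)
  have "1 - fps_X ^ b = fps_const 1 + fps_const (-1 :: 'a) * fps_X ^ b"
    by (simp add: fps_eq_iff)
  also have "\<dots> \<in> frobenius_series"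
    using m1 by (intro frobenius_add frobenius_mult frobenius_power frobenius_X frobenius_const)
      (auto simp: one_mem uminus_mem pideal_zero)
  finally have fr: "1 - fps_X ^ b \<in> frobenius_series" .
  have "fps_section p ((1 - fps_X ^ b) ^ p - fps_dilate p (1 - fps_X ^ b :: 'a fps)) = 0"
  proof (rule fps_ext)
    fix n
    have "(1 - fps_X ^ b :: 'a fps) ^ p = (\<Sum>k\<le>p. of_nat (p choose k) * (- (fps_X ^ b)) ^ k)"
      using binomial_ring[of "- (fps_X ^ b)" "1 :: 'a fps" p] by simp
    also have "{..p} = insert 0 (insert p {0<..<p})" using p_pos by auto
    finally have "(1 - fps_X ^ b) ^ p - fps_dilate p (1 - fps_X ^ b :: 'a fps) =
        (\<Sum>k\<in>{0<..<p}. of_nat (p choose k) * (- (fps_X ^ b)) ^ k)"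
      using assms(1) by (simp add: fps_dilate_simps p_pos power_minus_odd power_mult[symmetric] mult.commute)
    moreover have "(of_nat (p choose k) * (- (fps_X ^ b)) ^ k :: 'a fps) $ (p * n) = 0"
      if k: "k \<in> {0<..<p}" for k
    proof -
      have "\<not> p dvd k" using k by (auto dest: dvd_imp_le)
      then have "\<not> p dvd b * k" using assms(2) coprime_commute coprime_dvd_mult_right_iff by blast
      then have "b * k \<noteq> p * n" by (metis dvd_triv_left)
      then have "p * n \<noteq> b * k" by simp
      moreover have "of_nat (p choose k) * (- (fps_X ^ b)) ^ k
          = fps_const (of_nat (p choose k) * (-1) ^ k :: 'a) * fps_X ^ (b * k)"
        by (simp add: power_mult fps_of_nat power_minus[of "fps_X ^ b"]
            flip: fps_const_mult fps_const_power fps_const_neg)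
      ultimately show ?thesis by (simp only: fps_mult_left_const_nth fps_X_power_nth) simp
    qed
    ultimately show "fps_section p ((1 - fps_X ^ b) ^ p - fps_dilate p (1 - fps_X ^ b :: 'a fps)) $ n = 0 $ n"
      by (simp add: fps_sum_nth)
  qed
  then show ?thesis using fr pideal_zero[of 1] pseries_zero[of 2]
    by (auto simp: scalar_frobenius_def intro!: bexI[of _ 0])
qed

end

section \<open>Conjugate series and their logarithmic derivatives\<close>

lemma fps_degree_mult:
  fixes f g :: "'a::comm_ring_1 fps"
  assumes "\<And>i. i > m \<Longrightarrow> f $ i = 0" "\<And>i. i > n \<Longrightarrow> g $ i = 0" "i > m + n"
  shows "(f * g) $ i = 0"
  unfolding fps_mult_nth
proof (rule sum.neutral, rule ballI)
  fix k assume "k \<in> {0..i}"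
  then have "k > m \<or> i - k > n" using assms(3) by auto
  then show "f $ k * g $ (i - k) = 0" using assms(1,2) by auto
qed

lemma fps_degree_power:
  fixes f :: "'a::comm_ring_1 fps"
  assumes "\<And>i. i > m \<Longrightarrow> f $ i = 0"
  shows "i > k * m \<Longrightarrow> (f ^ k) $ i = 0"
proof (induction k arbitrary: i)
  case (Suc k)
  have "(f * f ^ k) $ i = 0"
  proof (rule fps_degree_mult[of m f "k * m" "f ^ k"])
    show "m + k * m < i" using Suc.prems by simp
  qed (auto intro: assms Suc.IH)
  then show ?case by simp
qed simp

text \<open>An exponent j < r can only pair exponent 0 of v with exponent j of b, and j > D.\<close>

lemma fps_support_mult_degree:
  fixes v b :: "'a::comm_ring_1 fps"
  assumes v: "\<And>n. v $ n \<noteq> 0 \<Longrightarrow> r dvd n" and b: "\<And>i. i > D \<Longrightarrow> b $ i = 0"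
    and "D < j" "j < r"
  shows "(v * b) $ j = 0"
  unfolding fps_mult_nth
proof (rule sum.neutral, rule ballI)
  fix k assume k: "k \<in> {0..j}"
  show "v $ k * b $ (j - k) = 0"
  proof (cases "k = 0")
    case True then show ?thesis using b[of j] assms by simp
  next
    case False
    then have "\<not> r dvd k" using k \<open>j < r\<close> by (auto dest: dvd_imp_le)
    then have "v $ k = 0" using v by blast
    then show ?thesis by simp
  qed
qed

text \<open>Only odd powers b^k survive in the difference, and they come with even powers of y,
  which are powers of the polynomial y^2.\<close>

lemma conjugate_power_difference_degree:
  fixes y b :: "'a::comm_ring_1 fps"
  assumes y: "\<And>i. i > r \<Longrightarrow> (y ^ 2) $ i = 0" and b: "\<And>i. i > D \<Longrightarrow> b $ i = 0"
    and "odd p" "r < 2 * (D + 1)" "n \<ge> (D + 1) * p"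
  shows "((y + b) ^ p - (y - b) ^ p) $ n = 0"
proof -
  have "(y + b) ^ p - (y - b) ^ p =
      (\<Sum>k\<le>p. of_nat (p choose k) * b ^ k * y ^ (p - k)) - (\<Sum>k\<le>p. of_nat (p choose k) * (- b) ^ k * y ^ (p - k))"
    using binomial_ring[of b y p] binomial_ring[of "- b" y p] by (simp add: add.commute)
  also have "\<dots> = (\<Sum>k\<le>p. of_nat (p choose k) * ((b ^ k - (- b) ^ k) * y ^ (p - k)))"
    by (simp add: sum_subtractf algebra_simps)
  finally have eq: "(y + b) ^ p - (y - b) ^ p = \<dots>" .
  have "(of_nat (p choose k) * ((b ^ k - (- b) ^ k) * y ^ (p - k))) $ n = 0" if "k \<le> p" for k
  proof (cases "even k")
    case False
    then have "even (p - k)" using \<open>odd p\<close> by simp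
    then obtain e where "p - k = 2 * e" by (elim evenE)
    then have e: "p = k + 2 * e" using that by simp
    \<comment> \<open>As p = k + 2 e and r \<le> 2 D + 1, the degree is at most D p + e, and e < p
      because k is odd.\<close>
    have "k * D + e * r \<le> k * D + e * (2 * D + 1)" using assms(4) by (intro add_left_mono mult_le_mono2) simp
    also have "\<dots> = D * p + e" by (simp add: e algebra_simps)
    also have "\<dots> < D * p + p" using e False by (auto elim: oddE)
    also have "\<dots> \<le> n" using assms(5) by (simp add: algebra_simps)
    finally have "(b ^ k * (y ^ 2) ^ e) $ n = 0"
      by (intro fps_degree_mult[of "k * D" _ "e * r"] fps_degree_power[of D] fps_degree_power[of r] b y)
    moreover have "(b ^ k - (- b) ^ k) * y ^ (p - k) = 2 * (b ^ k * (y ^ 2) ^ e)"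
      using False by (simp add: e algebra_simps flip: power_mult)
    then have "of_nat (p choose k) * ((b ^ k - (- b) ^ k) * y ^ (p - k))
        = fps_const (of_nat (p choose k) * 2) * (b ^ k * (y ^ 2) ^ e)"
      by (simp add: fps_of_nat numeral_fps_const flip: fps_const_mult)
    ultimately show ?thesis by (simp only: fps_mult_left_const_nth) simp
  qed simp
  then show ?thesis unfolding eq by (simp add: fps_sum_nth)
qed

context local_subring
begin

text \<open>If \<open>f\<^sup>p = F(x\<^sup>p) (1 + g)\<close>, then \<open>p x f'/f\<close> and \<open>p x\<^sup>p (F'/F)(x\<^sup>p)\<close> differ by
  \<open>x g'/(1 + g)\<close>, whose coefficient at \<open>pj\<close> is \<open>pj g\<^sub>p\<^sub>j\<close> up to \<open>p\<^sup>3\<close>.\<close>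

lemma theta_log_cong:
  assumes f: "f \<in> pseries 0" "f $ 0 \<noteq> 0" "inverse (f $ 0) \<in> R"
    and F: "F \<in> pseries 0" "F $ 0 \<noteq> 0" "inverse (F $ 0) \<in> R"
    and cong: "f ^ p - fps_dilate p F \<in> pseries 1"
    and half: "1 / 2 \<in> R"
    and g: "(fps_section p (f ^ p - fps_dilate p F) * inverse F) $ j \<in> pideal 2"
  shows "(fps_theta f * inverse f) $ (p * j) - (fps_theta F * inverse F) $ j \<in> pideal 2"
proof -
  define G where "G = fps_dilate p (inverse F)"
  define g where "g = (f ^ p - fps_dilate p F) * G"
  have GF: "fps_dilate p F * G = 1"
    using F(2) by (simp add: G_def fps_dilate_simps p_pos inverse_mult_eq_1' flip: fps_dilate_simps(3)[OF p_pos])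
  have G: "G \<in> pseries 0" unfolding G_def by (intro pseries_dilate pseries_inverse F)
  have g1: "g \<in> pseries 1" unfolding g_def by (intro pseries_mult_right cong G)
  have g0: "g \<in> pseries 0" using g1 by (rule pseries_antimono) simp
  have fp: "f ^ p = fps_dilate p F * (1 + g)"
    using GF by (simp add: g_def algebra_simps)
  have g_pj: "g $ (p * j) \<in> pideal 2"
    using assms(9) fps_section_dilate_mult[OF p_pos, of "inverse F" "f ^ p - fps_dilate p F"]
    by (metis G_def fps_section_nth g_def mult.commute)
  have nz: "f \<noteq> 0" "fps_dilate p F \<noteq> 0" "f ^ p \<noteq> 0" "1 + g \<noteq> 0"
    using f(2) GF fp by auto
  have gp0: "(1 + g) $ 0 \<noteq> 0" "inverse ((1 + g) $ 0) \<in> R"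
  proof -
    have e: "(f $ 0) ^ p = F $ 0 * (1 + g) $ 0"
      using arg_cong[OF fp, of "\<lambda>h. h $ 0"] by (simp add: fps_nth_power_0 fps_dilate_nth p_pos)
    show a: "(1 + g) $ 0 \<noteq> 0" using e f(2) by auto
    have "inverse ((1 + g) $ 0) = F $ 0 * inverse (f $ 0) ^ p"
      using a f(2) F(2) e
      by (simp add: divide_simps power_inverse[symmetric] del: fps_add_nth)
    also have "\<dots> \<in> R" using F f pseriesD[OF F(1), of 0] by (intro mult_mem power_mem) auto
    finally show "inverse ((1 + g) $ 0) \<in> R" .
  qed
  define K where "K = inverse (1 + g)"
  have K: "K \<in> pseries 0" unfolding K_def
    by (intro pseries_inverse pseries_add pseries_one g0 gp0)
  have K1: "(1 + g) * K = 1" unfolding K_def using gp0(1) by (rule inverse_mult_eq_1')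
  define A where "A = fps_theta f * inverse f"
  define B where "B = fps_theta F * inverse F"
  have A: "fps_theta f = A * f" using f(2) by (simp add: A_def mult.assoc inverse_mult_eq_1)
  have B: "fps_theta F = B * F" using F(2) by (simp add: B_def mult.assoc inverse_mult_eq_1)
  \<comment> \<open>The Euler operator is applied to f^p in two ways: directly, and through the
    product F(x^p) (1 + g).\<close>
  have "of_nat p * A * f ^ p = fps_theta (f ^ p)"
    using fps_theta_power[of f p] nz by (simp add: A algebra_simps)
  also have "\<dots> = of_nat p * fps_dilate p (B * F) * (1 + g) + fps_dilate p F * fps_theta g"
    unfolding fp fps_theta_mult by (simp add: fps_theta_dilate p_pos B) (simp add: fps_theta_def)
  also have "\<dots> = (of_nat p * fps_dilate p B + fps_theta g * K) * f ^ p"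
    using K1 by (simp add: fp fps_dilate_simps p_pos algebra_simps)
      (metis (no_types, lifting) distrib_left mult.left_commute mult_1_right distrib_right mult.commute)
  finally have pAB: "of_nat p * A = of_nat p * fps_dilate p B + fps_theta g * K"
    using nz by simp
  have K2: "K = 1 - g * K" using K1 by (simp add: algebra_simps eq_diff_eq)
  \<comment> \<open>Second-order expansion K = 1 - g + g^2 K.\<close>
  have "K = 1 - g * (1 - g * K)"
    using K2 arg_cong[OF K2, of "\<lambda>h. 1 - g * h"] by (rule trans)
  then have "fps_theta g * K = fps_theta g * (1 - g * (1 - g * K))"
    by (rule arg_cong)
  also have "\<dots> = fps_theta g - fps_theta g * g + fps_theta g * (g * g * K)"
    by (simp add: algebra_simps)
  \<comment> \<open>Writing this term as half the Euler derivative of g^2 exposes a factor p j at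
    index p j; divisibility of g by p alone would give only p^2 instead of p^3.\<close>
  also have "fps_theta g * g = (fps_const (1 / 2) * 2) * (fps_theta g * g)"
    by (simp add: numeral_fps_const)
  also have "\<dots> = fps_const (1 / 2) * fps_theta (g * g)"
    by (simp only: fps_theta_mult mult_2 algebra_simps)
  finally have "(fps_theta g * K) $ (p * j) = of_nat (p * j) * g $ (p * j)
      - 1 / 2 * (of_nat (p * j) * (g * g) $ (p * j)) + (fps_theta g * (g * g * K)) $ (p * j)"
    by (simp add: fps_theta_nth)
  also have "\<dots> \<in> pideal 3"
  proof (intro pideal_add pideal_diff)
    have pj: "of_nat (p * j) \<in> pideal 1" by (rule pideal_dvd) simp
    show "of_nat (p * j) * g $ (p * j) \<in> pideal 3"
      using pideal_mult[OF pj g_pj] by (simp add: numeral_3_eq_3 numeral_2_eq_2)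
    have gg: "g * g \<in> pseries 2" using pseries_mult[OF g1 g1] by (simp add: numeral_2_eq_2)
    show "1 / 2 * (of_nat (p * j) * (g * g) $ (p * j)) \<in> pideal 3"
      using pideal_mult[OF pj pseriesD[OF gg]]
      by (intro pideal_mult_left[OF half]) (simp add: numeral_3_eq_3 numeral_2_eq_2)
    have "fps_theta g * (g * g * K) \<in> pseries (1 + 2)"
      by (intro pseries_mult pseries_theta g1 pseries_mult_right gg K)
    from pseriesD[OF this, of "p * j"] show "(fps_theta g * (g * g * K)) $ (p * j) \<in> pideal 3"
      by (simp add: numeral_3_eq_3)
  qed
  finally have "(of_nat p * A - of_nat p * fps_dilate p B) $ (p * j) \<in> pideal 3"
    using pAB by simp
  moreover have "(of_nat p * A - of_nat p * fps_dilate p B) $ (p * j) = of_nat p * (A $ (p * j) - B $ j)"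
    by (simp add: fps_dilate_nth p_pos algebra_simps flip: fps_of_nat)
  ultimately have "of_nat p * (A $ (p * j) - B $ j) \<in> pideal (Suc 2)"
    by simp
  then show ?thesis unfolding A_def B_def by (rule pideal_cancel_p)
qed

text \<open>Let H and H' be the sections of the defects of f and its conjugate, and B = H - H'. The
  norm condition gives F' H + F H' = c N modulo p^2. Since F + F' = 2 y and N = F F', dividing by 2
  y F yields H / F = (B + c F') / (2 y), whose coefficient at j vanishes; this is what
  \<open>theta_log_cong\<close> asks for.\<close>

lemma theta_log_conjugates_cong:
  fixes v q :: "'a fps" and s \<epsilon> C :: 'a and r D j :: nat
  defines "P \<equiv> 1 + fps_const C * fps_X ^ r"
  defines "f \<equiv> P * v + fps_const s * q" and "F \<equiv> P * v + fps_const (\<epsilon> * s) * q"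
  assumes odd: "odd p" and half: "1 / 2 \<in> R"
    and C: "C \<in> R" "C ^ p - C \<in> pideal 1"
    and v: "v \<in> pseries 0" "v $ 0 = 1" "v ^ 2 * P = 1" "\<And>n. v $ n \<noteq> 0 \<Longrightarrow> r dvd n"
    and q: "q \<in> frobenius_series" "\<And>n. n > D \<Longrightarrow> q $ n = 0"
    and s: "s \<in> R" "\<epsilon> \<in> R" "\<epsilon> ^ 2 = 1" "s ^ p - \<epsilon> * s \<in> pideal 1"
    and N: "P - fps_const (s ^ 2) * q ^ 2 \<in> scalar_frobenius"
    and f0: "1 + s * q $ 0 \<noteq> 0" "inverse (1 + s * q $ 0) \<in> R"
    and F0: "1 + \<epsilon> * s * q $ 0 \<noteq> 0" "inverse (1 + \<epsilon> * s * q $ 0) \<in> R"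
    and j: "D < j" "j < r" "r < 2 * (D + 1)"
  shows "(fps_theta f * inverse f) $ (p * j) - (fps_theta F * inverse F) $ j \<in> pideal 2"
proof -
  define y where "y = P * v"
  define N where "N = P - fps_const (s ^ 2) * q ^ 2"
  define f' where "f' = y - fps_const s * q"
  define F' where "F' = y - fps_const (\<epsilon> * s) * q"
  have f_eq: "f = y + fps_const s * q" and F_eq: "F = y + fps_const (\<epsilon> * s) * q"
    by (simp_all add: f_def F_def y_def)
  have q0: "q \<in> pseries 0" using q by (simp add: frobenius_series_def)
  have "fps_const C \<in> frobenius_series" by (intro frobenius_const C)
  moreover have one_fr: "1 \<in> frobenius_series" using frobenius_power[OF frobenius_X, of 0] by simp
  ultimately have Pfr: "P \<in> frobenius_series"
    unfolding P_def by (intro frobenius_add frobenius_mult frobenius_power frobenius_X)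
  then have y0: "y \<in> pseries 0"
    unfolding y_def by (intro pseries_mult_left v) (simp add: frobenius_series_def)
  have r0: "r > 0" using j by simp
  have y1: "y $ 0 = 1" using v r0 by (simp add: y_def P_def)
  have ysq: "y ^ 2 = P" using v(3) by (simp add: y_def power2_eq_square algebra_simps)
  have yv: "y * v = 1" using v(3) by (simp add: y_def power2_eq_square algebra_simps)
  have yfr: "y \<in> frobenius_series"
    by (rule frobenius_root[OF y0 y1 _ half]) (simp add: ysq Pfr)
  have sq0: "fps_const s \<in> pseries 0" "fps_const (\<epsilon> * s) \<in> pseries 0"
    using s by (auto intro!: pseries_const mult_mem)
  have mem0: "f \<in> pseries 0" "F \<in> pseries 0" "f' \<in> pseries 0" "F' \<in> pseries 0"
    unfolding f_eq F_eq f'_def F'_def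
    by (intro pseries_add pseries_diff pseries_mult_left y0 q0 sq0)+
  \<comment> \<open>Because \<epsilon>^2 = 1, both conjugate pairs have the same norm.\<close>
  have ff': "f * f' = N" and FF': "F * F' = N"
    using s(3) by (simp_all add: f_eq F_eq f'_def F'_def N_def algebra_simps power2_eq_square flip: ysq fps_const_mult)
  have spow: "fps_const s ^ p - fps_const (\<epsilon> * s) \<in> pseries 1"
    using s(4) by (simp add: fps_const_power pseries_const)
  have qp: "q ^ p - fps_dilate p q \<in> pseries 1" and yp: "y ^ p - fps_dilate p y \<in> pseries 1"
    using q yfr by (auto simp: frobenius_series_def)
  have diff_mult_split: "a * b - c * d = (a - c) * b + c * (b - d)" for a b c d :: "'a fps"
    by (simp add: algebra_simps)
  have sqp: "fps_const s ^ p * q ^ p - fps_const (\<epsilon> * s) * fps_dilate p q \<in> pseries 1"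
  proof -
    have "fps_const s ^ p * q ^ p - fps_const (\<epsilon> * s) * fps_dilate p q =
        (fps_const s ^ p - fps_const (\<epsilon> * s)) * q ^ p + fps_const (\<epsilon> * s) * (q ^ p - fps_dilate p q)"
      using diff_mult_split by blast
    also have "\<dots> \<in> pseries 1"
      by (intro pseries_add pseries_mult_right[OF spow] pseries_mult_left[OF sq0(2)] qp pseries_power q0)
    finally show ?thesis .
  qed
  define \<Delta> where "\<Delta> = f ^ p - fps_dilate p F"
  define \<Delta>' where "\<Delta>' = f' ^ p - fps_dilate p F'"
  have \<Delta>1: "\<Delta> \<in> pseries 1"
  proof -
    have "\<Delta> = (f ^ p - (y ^ p + (fps_const s * q) ^ p)) + (y ^ p - fps_dilate p y)
        + (fps_const s ^ p * q ^ p - fps_const (\<epsilon> * s) * fps_dilate p q)"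
      by (simp add: \<Delta>_def F_eq fps_dilate_simps p_pos power_mult_distrib algebra_simps)
    also have "\<dots> \<in> pseries 1"
      unfolding f_eq by (intro pseries_add pseries_dream yp sqp y0 pseries_mult_left sq0 q0)
    finally show ?thesis .
  qed
  have \<Delta>'1: "\<Delta>' \<in> pseries 1"
  proof -
    have "\<Delta>' = ((y + (- (fps_const s * q))) ^ p - (y ^ p + (- (fps_const s * q)) ^ p)) + (y ^ p - fps_dilate p y)
        - (fps_const s ^ p * q ^ p - fps_const (\<epsilon> * s) * fps_dilate p q)"
      using odd by (simp add: \<Delta>'_def f'_def F'_def fps_dilate_simps p_pos power_mult_distrib
          power_minus_odd algebra_simps)
    also have "\<dots> \<in> pseries 1"
      by (intro pseries_add pseries_diff pseries_dream yp sqp y0 pseries_uminus pseries_mult_left sq0 q0)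
    finally show ?thesis .
  qed
  define H where "H = fps_section p \<Delta>"
  define H' where "H' = fps_section p \<Delta>'"
  define B where "B = H - H'"
  have ysq_deg: "(y ^ 2) $ i = 0" if "i > r" for i
    using that r0 by (simp add: ysq P_def)
  have sq_deg: "(fps_const s * q) $ i = 0" if "i > D" for i
    using q(2)[OF that] by simp
  \<comment> \<open>The section of f^p - f'^p vanishes above D by the degree bound, and F - F' = 2
    \<epsilon> s q has degree at most D.\<close>
  have B_deg: "B $ i = 0" if "i > D" for i
  proof -
    have le: "(D + 1) * p \<le> i * p" using that by (intro mult_le_mono1) simp
    have "fps_section p (f ^ p - f' ^ p) $ i = 0"
      unfolding fps_section_nth f_eq f'_def mult.commute[of p i]
      by (rule conjugate_power_difference_degree[OF ysq_deg sq_deg odd j(3) le])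
    moreover have "B = fps_section p (f ^ p - f' ^ p) - fps_section p (fps_dilate p (F - F'))"
      by (simp add: B_def H_def H'_def \<Delta>_def \<Delta>'_def fps_section_simps fps_dilate_simps p_pos)
    moreover have "(F - F') $ i = 0" 
      unfolding F_eq F'_def fps_sub_nth fps_add_nth using q(2)[OF that] by simp
    ultimately show ?thesis by (simp add: fps_section_dilate p_pos)
  qed
  obtain c where c: "c \<in> pideal 1"
    "fps_section p (N ^ p - fps_dilate p N) - fps_const c * N \<in> pseries 2"
    using N by (auto simp: scalar_frobenius_def N_def)
  \<comment> \<open>Expand N^p = f^p f'^p with f^p = F(x^p) + \<Delta> and its conjugate; \<Delta>
    \<Delta>' lies in p^2.\<close>
  have "N ^ p - fps_dilate p N = fps_dilate p F' * \<Delta> + fps_dilate p F * \<Delta>' + \<Delta> * \<Delta>'"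
    unfolding ff'[symmetric] power_mult_distrib
    unfolding ff' FF'[symmetric]
    by (simp add: \<Delta>_def \<Delta>'_def fps_dilate_simps p_pos algebra_simps)
  then have "fps_section p (N ^ p - fps_dilate p N) = F' * H + F * H' + fps_section p (\<Delta> * \<Delta>')"
    by (simp add: H_def H'_def fps_section_simps fps_section_dilate_mult p_pos)
  moreover have "fps_section p (\<Delta> * \<Delta>') \<in> pseries 2"
    using pseries_mult[OF \<Delta>1 \<Delta>'1] by (intro pseries_section) (simp add: numeral_2_eq_2)
  ultimately have "F' * H + F * H' + fps_section p (\<Delta> * \<Delta>') - fps_const c * N
      - fps_section p (\<Delta> * \<Delta>') \<in> pseries 2"
    using pseries_diff[OF c(2)] by metis
  then have "F' * H + F * H' - fps_const c * N \<in> pseries 2"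
    by (simp add: algebra_simps)
  also have "F' * H + F * H' - fps_const c * N = 2 * y * H - F * B - fps_const c * (F * F')"
    unfolding FF' by (simp add: B_def F_eq F'_def algebra_simps)
  finally have main: "2 * y * H - F * B - fps_const c * (F * F') \<in> pseries 2" .
  have Fnz: "F $ 0 \<noteq> 0" "inverse (F $ 0) \<in> R" using F0 y1 by (auto simp: F_eq)
  have fnz: "f $ 0 \<noteq> 0" "inverse (f $ 0) \<in> R" using f0 y1 by (auto simp: f_eq)
  have iF: "inverse F \<in> pseries 0" "F * inverse F = 1"
    using Fnz by (auto intro: pseries_inverse mem0 inverse_mult_eq_1')
  have half0: "fps_const (1/2) \<in> pseries 0" using half by (simp add: pseries_const)
  have "fps_const (1/2) * v * inverse F * (2 * y * H - F * B - fps_const c * (F * F')) \<in> pseries 2"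
    by (intro pseries_mult_left main half0 v iF)
  also have "fps_const (1/2) * v * inverse F * (2 * y * H - F * B - fps_const c * (F * F')) =
     (fps_const (1/2) * 2) * (y * v) * (H * inverse F) -
      fps_const (1/2) * (F * inverse F) * (v * B + fps_const c * (v * F'))"
    by (simp add: algebra_simps)
  also have "fps_const (1/2) * 2 = (1 :: 'a fps)"
    by (simp add: numeral_fps_const)
  also have "v * F' = 1 - fps_const (\<epsilon> * s) * (v * q)"
    using yv by (simp add: F'_def algebra_simps)
  finally have "H * inverse F - fps_const (1/2) * (v * B + fps_const c * (1 - fps_const (\<epsilon> * s) * (v * q))) \<in> pseries 2"
    using iF yv by simp
  \<comment> \<open>The constant 1 does not reach j > 0, and v B and v q have no coefficient at j
    since D < j < r.\<close>
  from pseriesD[OF this, of j] have "(H * inverse F) $ j \<in> pideal 2"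
    using fps_support_mult_degree[OF v(4) B_deg j(1,2)]
      fps_support_mult_degree[OF v(4) q(2) j(1,2)] j(1)
    by simp
  then show ?thesis
    using \<Delta>1 unfolding H_def \<Delta>_def
    by (intro theta_log_cong mem0 fnz Fnz half)
qed

end

section \<open>Truncated sums of central binomial coefficients\<close>

definition central_binomial_fps :: "'a::field_char_0 \<Rightarrow> 'a fps" where
  "central_binomial_fps c = Abs_fps (\<lambda>n. of_nat ((2 * n) choose n) * (- c) ^ n)"

lemma central_binomial_fps_nth [simp]:
  "central_binomial_fps c $ n = of_nat ((2 * n) choose n) * (- c) ^ n"
  by (simp add: central_binomial_fps_def)

lemma central_binomial_Suc:
  "Suc n * ((2 * Suc n) choose Suc n) = 2 * (2 * n + 1) * ((2 * n) choose n)"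
proof -
  have 1: "Suc n * ((2 * Suc n) choose Suc n) = 2 * Suc n * (Suc (2 * n) choose n)"
    using Suc_times_binomial[of n "Suc (2 * n)"] by simp
  have "Suc (2 * n) choose n = Suc (2 * n) choose Suc n"
    using binomial_symmetric[of n "Suc (2 * n)"] by (simp add: Suc_diff_le)
  moreover have "Suc n * (Suc (2 * n) choose Suc n) = Suc (2 * n) * ((2 * n) choose n)"
    by (rule Suc_times_binomial)
  ultimately show ?thesis using 1 by (simp only: mult.assoc Suc_eq_plus1)
qed

text \<open>The recursion of the central binomial coefficients is the differential equation G' (1 +
  4 c x) = -2 c G. It makes the derivative of G^2 (1 + 4 c x) vanish, and the constant term is
  1.\<close>

lemma central_binomial_fps_square:
  fixes c :: "'a::field_char_0"
  shows "central_binomial_fps c ^ 2 * (1 + fps_const (4 * c) * fps_X) = 1"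
proof -
  let ?G = "central_binomial_fps c"
  have ode: "fps_deriv ?G * (1 + fps_const (4 * c) * fps_X) = fps_const (- 2 * c) * ?G"
  proof (rule fps_ext)
    fix n
    have deriv: "fps_deriv ?G $ n = 2 * (2 * of_nat n + 1) * of_nat ((2 * n) choose n) * (- c) ^ Suc n" for n
      unfolding fps_deriv_nth central_binomial_fps_nth Suc_eq_plus1[symmetric]
      using arg_cong[OF central_binomial_Suc[of n], of "\<lambda>m. of_nat m * (- c) ^ Suc n :: 'a"]
      by (simp only: of_nat_mult of_nat_add of_nat_numeral of_nat_1 mult.assoc)
    have "fps_deriv ?G * (1 + fps_const (4 * c) * fps_X)
        = fps_deriv ?G + fps_const (4 * c) * fps_theta ?G"
      by (simp add: fps_theta_def algebra_simps)
    then have "(fps_deriv ?G * (1 + fps_const (4 * c) * fps_X)) $ n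
        = fps_deriv ?G $ n + 4 * c * (of_nat n * ?G $ n)"
      by (simp only: fps_add_nth fps_mult_left_const_nth fps_theta_nth)
    then show "(fps_deriv ?G * (1 + fps_const (4 * c) * fps_X)) $ n = (fps_const (- 2 * c) * ?G) $ n"
      unfolding deriv by (simp add: algebra_simps)
  qed
  have "fps_deriv (?G ^ 2 * (1 + fps_const (4 * c) * fps_X))
      = 2 * ?G * (fps_deriv ?G * (1 + fps_const (4 * c) * fps_X)) + fps_const (4 * c) * ?G ^ 2"
    by (simp add: power2_eq_square algebra_simps)
  also have "\<dots> = 0"
  proof -
    have "2 * g * (a * g) + b * g ^ 2 = (2 * a + b) * g ^ 2" for a b g :: "'a fps"
      by (simp add: power2_eq_square algebra_simps)
    then show ?thesis unfolding ode by (simp add: numeral_fps_const)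
  qed
  finally have "?G ^ 2 * (1 + fps_const (4 * c) * fps_X) =
      fps_const ((?G ^ 2 * (1 + fps_const (4 * c) * fps_X)) $ 0)"
    by (simp only: fps_deriv_eq_0_iff)
  then show ?thesis by (simp add: fps_nth_power_0)
qed

text \<open>With y = P v a square root of P, the quotient \<nu> + s \<mu> / y is the logarithmic
  derivative of f = y + s q. The hypotheses on P and q separate its defining equation into odd and
  even powers of y. Only s^2 occurs in them, so the same \<mu> and \<nu> serve for \<epsilon>
  s.\<close>

lemma theta_conjugate:
  fixes P v q \<mu> \<nu> :: "'a::field_char_0 fps" and s :: 'a
  assumes v: "v ^ 2 * P = 1"
    and P: "fps_theta P = 2 * (P * \<nu> + fps_const (s ^ 2) * (q * \<mu>))"
    and q: "fps_theta q = q * \<nu> + \<mu>"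
  shows "fps_theta (P * v + fps_const s * q) = (P * v + fps_const s * q) * (\<nu> + fps_const s * (v * \<mu>))"
proof -
  have vnz: "v \<noteq> 0" using v by auto
  have "fps_theta (v ^ 2 * P) = fps_theta 1" by (simp add: v)
  then have "v * (2 * P * fps_theta v + v * fps_theta P) = 0"
    by (simp add: fps_theta_mult power2_eq_square algebra_simps) (simp add: fps_theta_def)
  then have "2 * P * fps_theta v + v * fps_theta P = 0" using vnz by simp
  then have "2 * (fps_theta P * v + P * fps_theta v) = v * fps_theta P"
    by (simp add: algebra_simps eq_neg_iff_add_eq_0)
  also have "\<dots> = 2 * (v * (P * \<nu> + fps_const (s ^ 2) * (q * \<mu>)))"
    by (simp add: P)
  finally have "fps_theta P * v + P * fps_theta v = v * (P * \<nu> + fps_const (s ^ 2) * (q * \<mu>))"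
    by (subst (asm) mult_left_cancel) simp_all
  then have y: "fps_theta (P * v) = v * (P * \<nu> + fps_const (s ^ 2) * (q * \<mu>))"
    by (simp add: fps_theta_mult)
  have s2: "fps_const (s ^ 2) = fps_const s * fps_const s" by (simp add: power2_eq_square)
  have "fps_theta (P * v + fps_const s * q) = fps_theta (P * v) + fps_const s * fps_theta q"
    by (simp add: fps_theta_def algebra_simps)
  also have "\<dots> = P * v * \<nu> + fps_const s * q * \<nu> + fps_const s * \<mu>
      + fps_const s * fps_const s * (v * q * \<mu>)"
    unfolding y q s2 by (simp only: algebra_simps)
  \<comment> \<open>The factor v^2 P = 1 rewrites s \<mu> as s v \<mu> times P v, completing the
    product.\<close>
  also have "fps_const s * \<mu> = fps_const s * \<mu> * (v ^ 2 * P)" by (simp add: v)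
  finally show ?thesis by (simp only: algebra_simps power2_eq_square)
qed

text \<open>The dilated factor lives on multiples of r. For r k \<le> n the other index n - r k is
  at least n mod r, hence above D, and it has the residue of n modulo b; so every term of the
  convolution carries the same factor \<kappa>.\<close>

lemma dilated_central_mult_nth:
  assumes "r > 0" and \<mu>: "\<And>i. i > D \<Longrightarrow> i mod b = n mod b \<Longrightarrow> \<mu> $ i = \<kappa>"
    and "b dvd r" "n mod r > D"
  shows "(fps_dilate r (central_binomial_fps c) * \<mu>) $ n =
    \<kappa> * (\<Sum>k\<le>n div r. of_nat ((2 * k) choose k) * (- c) ^ k)"
proof -
  let ?v = "fps_dilate r (central_binomial_fps c)"
  have "(?v * \<mu>) $ n = (\<Sum>i=0..n. ?v $ i * \<mu> $ (n - i))"
    by (simp add: fps_mult_nth)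
  also have "\<dots> = (\<Sum>i\<in>(\<lambda>k. r * k) ` {..n div r}. ?v $ i * \<mu> $ (n - i))"
  proof (rule sum.mono_neutral_right)
    show "(\<lambda>k. r * k) ` {..n div r} \<subseteq> {0..n}"
      by (auto simp: less_eq_div_iff_mult_less_eq[OF \<open>r > 0\<close>] mult.commute)
    show "\<forall>i\<in>{0..n} - (\<lambda>k. r * k) ` {..n div r}. ?v $ i * \<mu> $ (n - i) = 0"
      using \<open>r > 0\<close> by (auto simp: fps_dilate_nth image_iff
          less_eq_div_iff_mult_less_eq mult.commute elim!: dvdE)
  qed simp
  also have "\<dots> = (\<Sum>k\<le>n div r. ?v $ (r * k) * \<mu> $ (n - r * k))"
    by (subst sum.reindex) (use \<open>r > 0\<close> in \<open>auto simp: inj_on_def\<close>)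
  also have "\<dots> = (\<Sum>k\<le>n div r. \<kappa> * (of_nat ((2 * k) choose k) * (- c) ^ k))"
  proof (rule sum.cong[OF refl])
    fix k assume "k \<in> {..n div r}"
    then have le: "r * k \<le> n"
      by (simp add: less_eq_div_iff_mult_less_eq[OF \<open>r > 0\<close>] mult.commute)
    then have n: "n = r * k + (n - r * k)" by simp
    have "n mod r = (n - r * k) mod r" using n by (metis mod_mult_self4)
    then have "D < n - r * k" using assms(4) mod_less_eq_dividend[of "n - r * k" r] by linarith
    moreover have "(n - r * k) mod b = n mod b"
      using n \<open>b dvd r\<close> by (metis dvd_def mod_mult_self4 mult.assoc)
    ultimately have "\<mu> $ (n - r * k) = \<kappa>" by (rule \<mu>)
    then show "?v $ (r * k) * \<mu> $ (n - r * k) = \<kappa> * (of_nat ((2 * k) choose k) * (- c) ^ k)"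
      using \<open>r > 0\<close> by (simp add: fps_dilate_nth)
  qed
  finally show ?thesis by (simp add: sum_distrib_left)
qed

context local_subring
begin

text \<open>The logarithmic derivative of f has coefficient \<kappa>' + s \<kappa> S at p j, with S
  the wanted sum; that of F has \<kappa>' + \<epsilon> s \<kappa> at j. Their difference s \<kappa>
  (S - \<epsilon>) lies in p^2 R, and s \<kappa> is a unit.\<close>

theorem central_binomial_sum_cong:
  fixes c s \<epsilon> \<kappa> \<kappa>' :: 'a and q \<mu> \<nu> :: "'a fps" and r D b j :: nat
  defines "P \<equiv> 1 + fps_const (4 * c) * fps_X ^ r"
  assumes odd: "odd p" and half: "1 / 2 \<in> R"
    and c: "c \<in> R" "(4 * c) ^ p - 4 * c \<in> pideal 1"
    and q: "q \<in> frobenius_series" "\<And>n. n > D \<Longrightarrow> q $ n = 0"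
    and s: "s \<in> R" "\<epsilon> \<in> R" "\<epsilon> ^ 2 = 1" "s ^ p - \<epsilon> * s \<in> pideal 1"
    and N: "P - fps_const (s ^ 2) * q ^ 2 \<in> scalar_frobenius"
    and f0: "1 + s * q $ 0 \<noteq> 0" "inverse (1 + s * q $ 0) \<in> R"
    and F0: "1 + \<epsilon> * s * q $ 0 \<noteq> 0" "inverse (1 + \<epsilon> * s * q $ 0) \<in> R"
    and j: "D < j" "j < r" "r < 2 * (D + 1)"
    and theta_P: "fps_theta P = 2 * (P * \<nu> + fps_const (s ^ 2) * (q * \<mu>))"
    and theta_q: "fps_theta q = q * \<nu> + \<mu>"
    and \<mu>: "\<And>i. i > D \<Longrightarrow> i mod b = j mod b \<Longrightarrow> \<mu> $ i = \<kappa>"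
    and \<nu>: "\<And>i. i > D \<Longrightarrow> i mod b = j mod b \<Longrightarrow> \<nu> $ i = \<kappa>'"
    and b: "b dvd r" "p mod r = 1"
    and units: "s \<noteq> 0" "inverse s \<in> R" "\<kappa> \<noteq> 0" "inverse \<kappa> \<in> R"
  shows "(\<Sum>k\<le>p * j div r. of_nat ((2 * k) choose k) * (- c) ^ k) - \<epsilon> \<in> pideal 2"
proof -
  define v where "v = fps_dilate r (central_binomial_fps c)"
  define f where "f = P * v + fps_const s * q"
  define F where "F = P * v + fps_const (\<epsilon> * s) * q"
  have r0: "r > 0" using j by simp
  have v2: "v ^ 2 * P = 1"
    using arg_cong[OF central_binomial_fps_square[of c], of "fps_dilate r"] r0
    by (simp add: v_def P_def fps_dilate_simps)
  have v_nth: "v $ n = (if r dvd n then of_nat ((2 * (n div r)) choose (n div r)) * (- c) ^ (n div r) else 0)" for n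
    using r0 by (simp add: v_def fps_dilate_nth)
  have v_mem: "v \<in> pseries 0"
    by (rule pseriesI) (auto simp: v_nth intro!: mult_mem of_nat_mem power_mem uminus_mem c zero_mem)
  have C: "4 * c \<in> R" using mult_mem[OF of_nat_mem[of 4] c(1)] by simp
  have v0: "v $ 0 = 1" by (simp add: v_nth)
  have v_supp: "r dvd n" if "v $ n \<noteq> 0" for n using that by (simp add: v_nth split: if_splits)
  \<comment> \<open>As p mod r = 1, the indices p j and j agree modulo r and b, so \<mu> and \<nu>
    take the same constants at both.\<close>
  have pmod_r: "(p * j) mod r = j" using b(2) j by (metis mod_less mod_mult_left_eq mult_1)
  have pmod: "(p * j) mod b = j mod b"
    using pmod_r b(1) by (metis mod_mod_cancel)
  have D: "D < p * j" using j(1) p_pos by (metis less_le_trans mult_le_mono1 nat_mult_1 Suc_leI One_nat_def)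
  have log: "(fps_theta f * inverse f) $ (p * j) - (fps_theta F * inverse F) $ j \<in> pideal 2"
    unfolding f_def F_def P_def
    by (rule theta_log_conjugates_cong[OF odd half C c(2) v_mem v0 v2[unfolded P_def] v_supp q s
          N[unfolded P_def] f0 F0 j])
  have f: "fps_theta f = f * (\<nu> + fps_const s * (v * \<mu>))"
    unfolding f_def by (rule theta_conjugate[OF v2 theta_P theta_q])
  have "fps_theta P = 2 * (P * \<nu> + fps_const ((\<epsilon> * s) ^ 2) * (q * \<mu>))"
    using theta_P s(3) by (simp add: power_mult_distrib)
  then have F: "fps_theta F = F * (\<nu> + fps_const (\<epsilon> * s) * (v * \<mu>))"
    unfolding F_def by (rule theta_conjugate[OF v2 _ theta_q])
  have "f $ 0 \<noteq> 0" "F $ 0 \<noteq> 0"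
    using f0 F0 r0 v0 by (auto simp: f_def F_def P_def)
  then have ff: "f * inverse f = 1" "F * inverse F = 1" by (auto intro: inverse_mult_eq_1')
  have lf: "fps_theta f * inverse f = \<nu> + fps_const s * (v * \<mu>)"
    using ff(1) by (simp add: f mult.commute mult.left_commute)
  have lF: "fps_theta F * inverse F = \<nu> + fps_const (\<epsilon> * s) * (v * \<mu>)"
    using ff(2) by (simp add: F mult.commute mult.left_commute)
  let ?S = "\<lambda>n. \<Sum>k\<le>n div r. of_nat ((2 * k) choose k) * (- c) ^ k"
  have "(v * \<mu>) $ n = \<kappa> * ?S n" if "n mod r = j" "n mod b = j mod b" for n
    unfolding v_def by (rule dilated_central_mult_nth[OF r0 _ b(1)]) (use that \<mu> j in auto)
  \<comment> \<open>Since j < r, the partial sum at j is its single term k = 0, equal to 1.\<close>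
  from this[of "p * j"] this[of j] have "(v * \<mu>) $ (p * j) = \<kappa> * ?S (p * j)" "(v * \<mu>) $ j = \<kappa>"
    using j pmod_r pmod by simp_all
  moreover have "\<nu> $ (p * j) + s * (v * \<mu>) $ (p * j) - (\<nu> $ j + \<epsilon> * s * (v * \<mu>) $ j) \<in> pideal 2"
    using log unfolding lf lF by simp
  moreover have "\<nu> $ (p * j) = \<nu> $ j" using \<nu> j D pmod by simp
  ultimately have "s * \<kappa> * (?S (p * j) - \<epsilon>) \<in> pideal 2"
    by (simp add: algebra_simps)
  from pideal_mult_left[OF units(2) pideal_mult_left[OF units(4) this]]
  have "inverse s * (inverse \<kappa> * (s * \<kappa> * (?S (p * j) - \<epsilon>))) \<in> pideal 2" .
  also have "inverse s * (inverse \<kappa> * (s * \<kappa> * (?S (p * j) - \<epsilon>))) = ?S (p * j) - \<epsilon>"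
    using units(1,3) by (simp add: field_simps del: right_diff_distrib_numeral)
  finally show ?thesis .
qed

end

section \<open>The torsion points\<close>

text \<open>The expansion of 1 / (1 - x^b).\<close>

definition fps_geometric :: "nat \<Rightarrow> 'a::field_char_0 fps" where
  "fps_geometric b = fps_dilate b (Abs_fps (\<lambda>n. 1))"

lemma fps_geometric_nth: "b > 0 \<Longrightarrow> fps_geometric b $ n = (if b dvd n then 1 else 0)"
  by (simp add: fps_geometric_def fps_dilate_nth)

lemma fps_geometric_inverse:
  assumes "b > 0"
  shows "(1 - fps_X ^ b) * fps_geometric b = (1 :: 'a::field_char_0 fps)"
proof -
  have "(1 - fps_X) * Abs_fps (\<lambda>n. 1) = (1 :: 'a fps)"
    unfolding fps_inverse_gp'[symmetric] by (rule inverse_mult_eq_1) simp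
  from arg_cong[OF this, of "fps_dilate b"] show ?thesis
    using assms by (simp add: fps_geometric_def fps_dilate_simps)
qed

lemma fps_of_poly_geometric_nth:
  fixes m :: "'a::field_char_0 poly"
  assumes "b > 0" "degree m \<le> D" "D \<le> n"
  shows "(fps_of_poly m * fps_geometric b) $ n = (\<Sum>i=0..D. coeff m i * (if b dvd n - i then 1 else 0))"
proof -
  have "(fps_of_poly m * fps_geometric b) $ n = (\<Sum>i=0..n. coeff m i * (if b dvd n - i then 1 else 0))"
    using assms(1) by (simp add: fps_mult_nth fps_geometric_nth)
  also have "\<dots> = (\<Sum>i=0..D. coeff m i * (if b dvd n - i then 1 else 0))"
    by (rule sum.mono_neutral_right) (use assms in \<open>auto simp: coeff_eq_0\<close>)
  finally show ?thesis .
qed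

lemma fps_theta_of_poly: "fps_theta (fps_of_poly q) = fps_of_poly (pCons 0 (pderiv q))"
  by (simp add: fps_theta_def fps_of_poly_pCons fps_of_poly_pderiv mult.commute)

context local_subring
begin

definition frobenius_fixed :: "'a set" where
  "frobenius_fixed = {x \<in> R. x ^ p - x \<in> pideal 1}"

lemma frobenius_fixed_const: "x \<in> frobenius_fixed \<Longrightarrow> fps_const x \<in> frobenius_series"
  by (simp add: frobenius_fixed_def frobenius_const)

text \<open>Fermat's little theorem: 1 is a Frobenius series and sums of such series are again such;
  the constant coefficient of the congruence is n^p - n.\<close>

lemma frobenius_fixed_of_nat: "of_nat n \<in> frobenius_fixed"
proof -
  have "of_nat n \<in> frobenius_series"
  proof (induction n)
    case (Suc n)
    have "1 \<in> frobenius_series" using frobenius_power[OF frobenius_X, of 0] by simp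
    then show ?case using Suc by (simp add: frobenius_add)
  qed (simp add: frobenius_series_def fps_dilate_def pseries_zero power_0_left)
  then have "(of_nat n ^ p - fps_dilate p (of_nat n :: 'a fps)) $ 0 \<in> pideal 1"
    by (intro pseriesD) (simp add: frobenius_series_def)
  then show ?thesis
    by (simp add: frobenius_fixed_def of_nat_mem fps_dilate_nth p_pos fps_nth_power_0)
qed

lemma frobenius_fixed_numeral: "numeral n \<in> frobenius_fixed"
  using frobenius_fixed_of_nat[of "numeral n"] by simp

lemma frobenius_fixed_0: "0 \<in> frobenius_fixed" and frobenius_fixed_1: "1 \<in> frobenius_fixed"
  using frobenius_fixed_of_nat[of 0] frobenius_fixed_of_nat[of 1] by simp_all

lemma frobenius_fixed_uminus: "odd p \<Longrightarrow> x \<in> frobenius_fixed \<Longrightarrow> - x \<in> frobenius_fixed"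
  using pideal_diff[OF pideal_zero[of 1], of "x ^ p - x"]
  by (simp add: frobenius_fixed_def uminus_mem power_minus_odd)

lemma frobenius_fixed_inverse:
  assumes x: "x \<in> frobenius_fixed" and i: "inverse x \<in> R"
  shows "inverse x \<in> frobenius_fixed"
proof (cases "x = 0")
  case False
  have "inverse x ^ p - inverse x = (inverse x ^ p * - inverse x) * (x ^ p - x)"
    using False by (simp add: field_simps)
  also have "\<dots> \<in> pideal 1"
    using x i by (intro pideal_mult_left mult_mem power_mem uminus_mem) (auto simp: frobenius_fixed_def)
  finally show ?thesis using i by (simp add: frobenius_fixed_def)
qed (use assms in simp)

lemma frobenius_pCons:
  "a \<in> frobenius_fixed \<Longrightarrow> fps_of_poly q \<in> frobenius_series \<Longrightarrow> fps_of_poly (pCons a q) \<in> frobenius_series"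
  unfolding fps_of_poly_pCons
  by (intro frobenius_add frobenius_mult frobenius_fixed_const frobenius_X)

lemma frobenius_poly_0: "fps_of_poly 0 \<in> frobenius_series"
  using frobenius_const[of 0] by (simp add: zero_mem pideal_zero power_0_left)

lemmas frobenius_poly_intros =
  frobenius_pCons frobenius_poly_0 frobenius_fixed_0 frobenius_fixed_1 frobenius_fixed_numeral
  frobenius_fixed_uminus frobenius_fixed_inverse

text \<open>The polynomials \<open>n\<close> and \<open>m\<close> are read off from \<open>x (1 - x\<^sup>b) (d/dx f) / f = n + s m / y\<close>.\<close>

theorem central_binomial_sum_cong_poly:
  fixes c s \<epsilon> \<kappa> \<kappa>' :: 'a and P q w m n :: "'a poly" and r D b j :: nat
  assumes odd: "odd p" and half: "1 / 2 \<in> R"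
    and c: "c \<in> R" "4 * c \<in> frobenius_fixed"
    and P: "fps_of_poly P = 1 + fps_const (4 * c) * fps_X ^ r"
    and w: "fps_of_poly w = 1 - fps_X ^ b" "b > 0"
    and q: "fps_of_poly q \<in> frobenius_series" "degree q \<le> D"
    and s: "s \<in> R" "\<epsilon> \<in> R" "\<epsilon> ^ 2 = 1" "s ^ p - \<epsilon> * s \<in> pideal 1"
    and N: "fps_of_poly (P - smult (s ^ 2) (q ^ 2)) \<in> scalar_frobenius"
    and f0: "1 + s * coeff q 0 \<noteq> 0" "inverse (1 + s * coeff q 0) \<in> R"
    and F0: "1 + \<epsilon> * s * coeff q 0 \<noteq> 0" "inverse (1 + \<epsilon> * s * coeff q 0) \<in> R"
    and j: "D < j" "j < r" "r < 2 * (D + 1)"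
    and theta_P: "w * pCons 0 (pderiv P) = 2 * (P * n + smult (s ^ 2) (q * m))"
    and theta_q: "w * pCons 0 (pderiv q) = q * n + m"
    and m: "degree m \<le> D + 1" "\<And>i. i > D \<Longrightarrow> i mod b = j mod b \<Longrightarrow>
        (\<Sum>k=0..D+1. coeff m k * (if b dvd i - k then 1 else 0)) = \<kappa>"
    and n: "degree n \<le> D + 1" "\<And>i. i > D \<Longrightarrow> i mod b = j mod b \<Longrightarrow>
        (\<Sum>k=0..D+1. coeff n k * (if b dvd i - k then 1 else 0)) = \<kappa>'"
    and b: "b dvd r" "p mod r = 1"
    and units: "s \<noteq> 0" "inverse s \<in> R" "\<kappa> \<noteq> 0" "inverse \<kappa> \<in> R"
  shows "(\<Sum>k\<le>p * j div r. of_nat ((2 * k) choose k) * (- c) ^ k) - \<epsilon> \<in> pideal 2"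
proof -
  \<comment> \<open>Multiplying by the geometric series divides by w = 1 - x^b.\<close>
  have geo: "A = fps_geometric b * fps_of_poly B" if "fps_of_poly w * A = fps_of_poly B" for A B
  proof -
    have "fps_geometric b * fps_of_poly B = ((1 - fps_X ^ b) * fps_geometric b) * A"
      by (simp add: w(1) flip: that)
    then show ?thesis by (simp add: fps_geometric_inverse w(2))
  qed
  have tP: "fps_theta (fps_of_poly P) = fps_geometric b * fps_of_poly (2 * (P * n + smult (s ^ 2) (q * m)))"
    by (rule geo) (simp only: fps_theta_of_poly theta_P flip: fps_of_poly_mult)
  have tq: "fps_theta (fps_of_poly q) = fps_geometric b * fps_of_poly (q * n + m)"
    by (rule geo) (simp only: fps_theta_of_poly theta_q flip: fps_of_poly_mult)
  show ?thesis
  proof (rule central_binomial_sum_cong[where s = s and D = D and b = b and \<kappa> = \<kappa> and \<kappa>' = \<kappa>'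
        and q = "fps_of_poly q" and \<mu> = "fps_of_poly m * fps_geometric b"
        and \<nu> = "fps_of_poly n * fps_geometric b"])
    show "fps_of_poly q $ i = 0" if "i > D" for i using q(2) that by (simp add: coeff_eq_0)
    show "1 + fps_const (4 * c) * fps_X ^ r - fps_const (s ^ 2) * fps_of_poly q ^ 2 \<in> scalar_frobenius"
      using N by (simp add: fps_of_poly_simps P fps_of_poly_power)
    show "fps_theta (1 + fps_const (4 * c) * fps_X ^ r) = 2 * ((1 + fps_const (4 * c) * fps_X ^ r) *
        (fps_of_poly n * fps_geometric b) + fps_const (s ^ 2) * (fps_of_poly q * (fps_of_poly m * fps_geometric b)))"
      unfolding P[symmetric] tP by (simp add: fps_of_poly_simps algebra_simps)
    show "fps_theta (fps_of_poly q) = fps_of_poly q * (fps_of_poly n * fps_geometric b) + fps_of_poly m * fps_geometric b"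
      unfolding tq by (simp add: fps_of_poly_simps algebra_simps)
    show "(fps_of_poly m * fps_geometric b) $ i = \<kappa>" if "i > D" "i mod b = j mod b" for i
      using m(2)[OF that] that by (subst fps_of_poly_geometric_nth[OF w(2) m(1)]) auto
    show "(fps_of_poly n * fps_geometric b) $ i = \<kappa>'" if "i > D" "i mod b = j mod b" for i
      using n(2)[OF that] that by (subst fps_of_poly_geometric_nth[OF w(2) n(1)]) auto
    show "(4 * c) ^ p - 4 * c \<in> pideal 1" using c(2) by (simp add: frobenius_fixed_def)
  qed (unfold fps_of_poly_nth, (rule assms)+)
qed

section \<open>The explicit functions on the two curves\<close>

lemma central_sum_pow_2:
  assumes "odd p" "1 / 2 \<in> R" "1 / 3 \<in> R" "p mod 3 = 1"
  shows "(\<Sum>k\<le>p * 2 div 3. of_nat ((2 * k) choose k) * (- 2) ^ k) - 1 \<in> pideal 2"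
\<comment> \<open>The line y = 4 x - 1 is tangent to y^2 = 1 + 8 x^3 at the 6-torsion point (1, 3)
  and meets it again at (0, -1); hence N = 8 x (1 - x)^2 for q = 1 - 4 x. Since b = 1, \<kappa> =
  m(1) and \<kappa>' = n(1).\<close>
proof (rule central_binomial_sum_cong_poly[where s = 1 and b = 1 and D = 1
      and P = "[:1, 0, 0, 8:]" and w = "[:1, -1:]" and q = "[:1, -4:]"
      and n = "[:1/2, -3/2:]" and m = "[:-1/2, -1/2, -2:]" and \<kappa> = "-3" and \<kappa>' = "-1"])
  have half: "inverse 2 \<in> R" using assms(2) by (simp add: field_simps)
  have i8: "inverse 8 \<in> R" using power_mem[OF half, of 3] by (simp add: field_simps)
  have "fps_const 8 * (fps_X * (1 - fps_X ^ 1) ^ 2) \<in> scalar_frobenius"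
    using frobenius_fixed_numeral[of "num.Bit0 (num.Bit0 (num.Bit0 num.One))"] assms
    by (intro scalar_frobenius_mult scalar_frobenius_power scalar_frobenius_one_minus_X_power
        scalar_frobenius_X scalar_frobenius_const i8) (auto simp: frobenius_fixed_def)
  also have "fps_const 8 * (fps_X * (1 - fps_X ^ 1) ^ 2) = fps_of_poly ([:8:] * ([:0, 1:] * [:1, -1:: 'a:] ^ 2))"
    by (simp only: fps_of_poly_mult fps_of_poly_power) (simp add: fps_of_poly_pCons)
  also have "[:8:] * ([:0, 1:] * [:1, -1:] ^ 2) = [:1, 0, 0, 8:] - smult (1 ^ 2) ([:1, -4:: 'a:] ^ 2)"
    by (simp add: power2_eq_square)
  finally show "fps_of_poly ([:1, 0, 0, 8:] - smult (1 ^ 2) ([:1, -4:] ^ 2)) \<in> scalar_frobenius" .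
  show "fps_of_poly [:1, -4:] \<in> frobenius_series"
    by (intro frobenius_poly_intros assms)
  show "4 * 2 \<in> frobenius_fixed"
    using frobenius_fixed_numeral[of "num.Bit0 (num.Bit0 (num.Bit0 num.One))"] by simp
  show "2 \<in> R" using of_nat_mem[of 2] by simp
  show "inverse (1 + 1 * coeff [:1, -4:] 0) \<in> R" "inverse (1 + 1 * 1 * coeff [:1, -4:] 0) \<in> R"
    using half by simp_all
  show "inverse (-3) \<in> R" using uminus_mem[OF assms(3)] by (simp add: field_simps)
  show "fps_of_poly [:1, 0, 0, 8 :: 'a:] = 1 + fps_const (4 * 2) * fps_X ^ 3"
    by (simp add: fps_of_poly_pCons numeral_3_eq_3 mult.assoc)
  show "[:1, -1 :: 'a:] * pCons 0 (pderiv [:1, 0, 0, 8:]) =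
      2 * ([:1, 0, 0, 8:] * [:1/2, -3/2:] + smult (1 ^ 2) ([:1, -4:] * [:-1/2, -1/2, -2:: 'a:]))"
    by (simp add: pderiv_pCons numeral_poly)
  show "[:1, -1 :: 'a:] * pCons 0 (pderiv [:1, -4:]) = [:1, -4:] * [:1/2, -3/2:] + [:-1/2, -1/2, -2:: 'a:]"
    by (simp add: pderiv_pCons)
qed (use assms in \<open>auto simp: one_mem pideal_zero fps_of_poly_pCons numeral_2_eq_2 sum.atLeast0_atMost_Suc\<close>)

text \<open>The function used for the powers of -2, expanded at infinity: put 1 / x^2 for x and
  multiply by x^3 / (2 sqrt 2). Then 1 - 4 x becomes q sqrt 2 and N becomes (1 - x^2)^2. The
  irrational scaling is what brings in \<epsilon>.\<close>

lemma central_sum_inverse_pow_32: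
  assumes "odd p" "1 / 2 \<in> R" "1 / 3 \<in> R" "p mod 6 = 1"
    and s: "s \<in> R" "s ^ 2 = 2" "\<epsilon> \<in> R" "\<epsilon> ^ 2 = 1" "s ^ p - \<epsilon> * s \<in> pideal 1"
  shows "(\<Sum>k\<le>p * 5 div 6. of_nat ((2 * k) choose k) * (- (1 / 32)) ^ k) - \<epsilon> \<in> pideal 2"
\<comment> \<open>D = 4 exceeds the degree of q because D + 1 must bound the degree 5 of m. At odd
  indices the odd polynomial m contributes its coefficient sum -3/2, and the even polynomial n
  contributes 0.\<close>
proof (rule central_binomial_sum_cong_poly[where s = s and b = 2 and D = 4
      and P = "[:1, 0, 0, 0, 0, 0, 1/8:]" and w = "[:1, 0, -1:]" and q = "[:0, -1, 0, 1/4:]"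
      and n = "[:0, 0, -2:]" and m = "[:0, -1, 0, -1/4, 0, -1/4:]" and \<kappa> = "-3/2" and \<kappa>' = 0])
  have half: "inverse 2 \<in> R" using assms(2) by (simp add: field_simps)
  have i8: "inverse 8 \<in> R" using power_mem[OF half, of 3] by (simp add: field_simps)
  have i4: "inverse 4 \<in> R" using power_mem[OF half, of 2] by (simp add: field_simps)
  have snz: "s \<noteq> 0" using s(2) by auto
  have "(1 - fps_X ^ 2) ^ 2 \<in> scalar_frobenius"
    using assms by (intro scalar_frobenius_power scalar_frobenius_one_minus_X_power) auto
  also have "(1 - fps_X ^ 2) ^ 2 = fps_of_poly ([:1, 0, -1:: 'a:] ^ 2)"
    by (simp only: fps_of_poly_power) (simp add: fps_of_poly_pCons power2_eq_square)
  also have "[:1, 0, -1:] ^ 2 = [:1, 0, 0, 0, 0, 0, 1/8:] - smult (s ^ 2) ([:0, -1, 0, 1/4:: 'a:] ^ 2)"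
    unfolding s(2) by (simp add: power2_eq_square)
  finally show "fps_of_poly ([:1, 0, 0, 0, 0, 0, 1/8:] - smult (s ^ 2) ([:0, -1, 0, 1/4:] ^ 2)) \<in> scalar_frobenius" .
  show "fps_of_poly [:0, -1, 0, 1/4:] \<in> frobenius_series"
    unfolding inverse_eq_divide[symmetric] by (intro frobenius_poly_intros assms i4)
  have "inverse 8 \<in> frobenius_fixed" by (intro frobenius_poly_intros i8)
  then show "4 * (1 / 32) \<in> frobenius_fixed" by (simp add: field_simps)
  show "1 / 32 \<in> R" using power_mem[OF half, of 5] by (simp add: field_simps)
  show "inverse (- 3 / 2) \<in> R"
    using uminus_mem[OF mult_mem[OF of_nat_mem[of 2] assms(3)]] by simp
  have inv_s: "inverse s = s * inverse 2" using s(2) snz by (simp add: field_simps power2_eq_square)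
  show "inverse s \<in> R" unfolding inv_s by (intro mult_mem s half)
  show "fps_of_poly [:1, 0, 0, 0, 0, 0, 1/8 :: 'a:] = 1 + fps_const (4 * (1 / 32)) * fps_X ^ 6"
    by (simp add: fps_of_poly_pCons eval_nat_numeral mult.assoc)
  show "[:1, 0, -1 :: 'a:] * pCons 0 (pderiv [:1, 0, 0, 0, 0, 0, 1/8:]) =
      2 * ([:1, 0, 0, 0, 0, 0, 1/8:] * [:0, 0, -2:] + smult (s ^ 2) ([:0, -1, 0, 1/4:] * [:0, -1, 0, -1/4, 0, -1/4:]))"
    unfolding s(2) by (simp add: pderiv_pCons numeral_poly)
  show "[:1, 0, -1 :: 'a:] * pCons 0 (pderiv [:0, -1, 0, 1/4:]) =
      [:0, -1, 0, 1/4:] * [:0, 0, -2:] + [:0, -1, 0, -1/4, 0, -1/4:]"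
    by (simp add: pderiv_pCons)
  fix i :: nat assume "4 < i" "i mod 2 = 5 mod 2"
  then have "odd i" "4 < i" by (simp_all add: odd_iff_mod_2_eq_one)
  then show "(\<Sum>k=0..4+1. coeff [:0, -1, 0, -1/4, 0, -1/4 :: 'a:] k * (if 2 dvd i - k then 1 else 0)) = -3/2"
    "(\<Sum>k=0..4+1. coeff [:0, 0, -2 :: 'a:] k * (if 2 dvd i - k then 1 else 0)) = 0"
    by (simp_all add: eval_nat_numeral sum.atLeast0_atMost_Suc) presburger+
qed (use assms in \<open>auto simp: one_mem fps_of_poly_pCons power2_eq_square\<close>)

text \<open>On y^2 = 1 + 4 x^5 the function y + sqrt 5 (1 - 2 x + 2 x^2) vanishes to order 5 at (1,
  -sqrt 5), so N = -4 (1 - x)^5. Both j = 3 and j = 4 lie between D = 2 and r = 5, so one function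
  yields two sums.\<close>

lemma central_sum_pow_1:
  assumes "odd p" "1 / 2 \<in> R" "1 / 5 \<in> R" "p mod 5 = 1"
    and s: "s \<in> R" "s ^ 2 = 5" "s ^ p - s \<in> pideal 1" and j: "2 < j" "j < 5"
  shows "(\<Sum>k\<le>p * j div 5. of_nat ((2 * k) choose k) * (- 1) ^ k) - 1 \<in> pideal 2"
proof (rule central_binomial_sum_cong_poly[where s = s and b = 1 and D = 2
      and P = "[:1, 0, 0, 0, 0, 4:]" and w = "[:1, -1:]" and q = "[:1, -2, 2:]"
      and n = "[:0, -5/2:]" and m = "[:0, 1/2, 1, 1:]" and \<kappa> = "5/2" and \<kappa>' = "-5/2"])
  have half: "inverse 2 \<in> R" using assms(2) by (simp add: field_simps)
  have i4: "inverse 4 \<in> R" using power_mem[OF half, of 2] by (simp add: field_simps)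
  have snz: "s \<noteq> 0" using s(2) by auto
  have m4: "- 4 \<in> frobenius_fixed" by (intro frobenius_poly_intros assms)
  have "fps_const (- 4) * (1 - fps_X ^ 1) ^ 5 \<in> scalar_frobenius"
    using m4 assms uminus_mem[OF i4]
    by (intro scalar_frobenius_mult scalar_frobenius_power scalar_frobenius_one_minus_X_power
        scalar_frobenius_const) (auto simp: frobenius_fixed_def)
  also have "fps_const (- 4) * (1 - fps_X ^ 1) ^ 5 = fps_of_poly ([:- 4:] * [:1, -1:: 'a:] ^ 5)"
    by (simp only: fps_of_poly_mult fps_of_poly_power) (simp add: fps_of_poly_pCons)
  also have "[:- 4:] * [:1, -1:] ^ 5 = [:1, 0, 0, 0, 0, 4:] - smult (s ^ 2) ([:1, -2, 2:: 'a:] ^ 2)"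
    unfolding s(2) by (simp add: eval_nat_numeral)
  finally show "fps_of_poly ([:1, 0, 0, 0, 0, 4:] - smult (s ^ 2) ([:1, -2, 2:] ^ 2)) \<in> scalar_frobenius" .
  show "fps_of_poly [:1, -2, 2:] \<in> frobenius_series"
    by (intro frobenius_poly_intros assms)
  show "4 * 1 \<in> frobenius_fixed"
    using frobenius_fixed_numeral[of "num.Bit0 (num.Bit0 num.One)"] by simp
  \<comment> \<open>The constant term 1 + sqrt 5 of f is a unit because its product with sqrt 5 - 1
    is 4.\<close>
  have unit: "(1 + s) * (s - 1) = 4" using s(2) by (simp add: algebra_simps power2_eq_square)
  then have nz: "1 + s \<noteq> 0" by auto
  then have "inverse (1 + s) = (s - 1) * inverse 4" using unit by (simp add: field_simps)
  also have "\<dots> \<in> R" by (intro mult_mem diff_mem s one_mem i4)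
  finally show "inverse (1 + s * coeff [:1, -2, 2:] 0) \<in> R" "inverse (1 + 1 * s * coeff [:1, -2, 2:] 0) \<in> R"
    by simp_all
  show "1 + s * coeff [:1, -2, 2:] 0 \<noteq> 0" "1 + 1 * s * coeff [:1, -2, 2:] 0 \<noteq> 0"
    using nz by simp_all
  show "inverse (5 / 2) \<in> R"
    using mult_mem[OF of_nat_mem[of 2] assms(3)] by simp
  have inv_s: "inverse s = s * (1 / 5)" using s(2) snz by (simp add: field_simps power2_eq_square)
  show "inverse s \<in> R" unfolding inv_s by (intro mult_mem s assms)
  show "fps_of_poly [:1, 0, 0, 0, 0, 4 :: 'a:] = 1 + fps_const (4 * 1) * fps_X ^ 5"
    by (simp add: fps_of_poly_pCons eval_nat_numeral mult.assoc)
  show "[:1, -1 :: 'a:] * pCons 0 (pderiv [:1, 0, 0, 0, 0, 4:]) =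
      2 * ([:1, 0, 0, 0, 0, 4:] * [:0, -5/2:] + smult (s ^ 2) ([:1, -2, 2:] * [:0, 1/2, 1, 1:]))"
    unfolding s(2) by (simp add: pderiv_pCons numeral_poly)
  show "s ^ p - 1 * s \<in> pideal 1" using s(3) by simp
  fix i :: nat assume "2 < i" "i mod 1 = j mod 1"
  then show "(\<Sum>k=0..2+1. coeff [:0, 1/2, 1, 1 :: 'a:] k * (if 1 dvd i - k then 1 else 0)) = 5/2"
    "(\<Sum>k=0..2+1. coeff [:0, -5/2 :: 'a:] k * (if 1 dvd i - k then 1 else 0)) = -5/2"
    by (simp_all add: eval_nat_numeral sum.atLeast0_atMost_Suc)
qed (use assms in \<open>auto simp: one_mem fps_of_poly_pCons pderiv_pCons\<close>)

text \<open>The preceding function at infinity: 1 / x^2 for x and multiplication by x^5 / 2 turn 1 -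
  2 x + 2 x^2 into q and N into (1 - x^2)^5. As m is odd and b = 2, a nonzero \<kappa> requires odd
  j, which leaves 7 and 9.\<close>

lemma central_sum_inverse_pow_16:
  assumes "odd p" "1 / 2 \<in> R" "1 / 5 \<in> R" "p mod 10 = 1"
    and s: "s \<in> R" "s ^ 2 = 5" "s ^ p - s \<in> pideal 1" and j: "5 < j" "j < 10" "odd j"
  shows "(\<Sum>k\<le>p * j div 10. of_nat ((2 * k) choose k) * (- (1 / 16)) ^ k) - 1 \<in> pideal 2"
proof (rule central_binomial_sum_cong_poly[where s = s and b = 2 and D = 5
      and P = "[:1, 0, 0, 0, 0, 0, 0, 0, 0, 0, 1/4:]" and w = "[:1, 0, -1:]" and q = "[:0, 1, 0, -1, 0, 1/2:]"
      and n = "[:0, 0, -5:]" and m = "[:0, 1, 0, 1, 0, 1/2:]" and \<kappa> = "5/2" and \<kappa>' = 0])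
  have half: "inverse 2 \<in> R" using assms(2) by (simp add: field_simps)
  have i4: "inverse 4 \<in> R" using power_mem[OF half, of 2] by (simp add: field_simps)
  have snz: "s \<noteq> 0" using s(2) by auto
  have "(1 - fps_X ^ 2) ^ 5 \<in> scalar_frobenius"
    using assms by (intro scalar_frobenius_power scalar_frobenius_one_minus_X_power) auto
  also have "(1 - fps_X ^ 2) ^ 5 = fps_of_poly ([:1, 0, -1:: 'a:] ^ 5)"
    by (simp only: fps_of_poly_power) (simp add: fps_of_poly_pCons power2_eq_square)
  also have "[:1, 0, -1:] ^ 5 = [:1, 0, 0, 0, 0, 0, 0, 0, 0, 0, 1/4:] - smult (s ^ 2) ([:0, 1, 0, -1, 0, 1/2:: 'a:] ^ 2)"
    unfolding s(2) by (simp add: eval_nat_numeral)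
  finally show "fps_of_poly ([:1, 0, 0, 0, 0, 0, 0, 0, 0, 0, 1/4:] - smult (s ^ 2) ([:0, 1, 0, -1, 0, 1/2:] ^ 2)) \<in> scalar_frobenius" .
  show "fps_of_poly [:0, 1, 0, -1, 0, 1/2:] \<in> frobenius_series"
    unfolding inverse_eq_divide[symmetric] by (intro frobenius_poly_intros assms half)
  have "inverse 4 \<in> frobenius_fixed" by (intro frobenius_poly_intros i4)
  then show "4 * (1 / 16) \<in> frobenius_fixed" by (simp add: field_simps)
  show "1 / 16 \<in> R" using power_mem[OF half, of 4] by (simp add: field_simps)
  show "inverse (5 / 2) \<in> R"
    using mult_mem[OF of_nat_mem[of 2] assms(3)] by simp
  have inv_s: "inverse s = s * (1 / 5)" using s(2) snz by (simp add: field_simps power2_eq_square)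
  show "inverse s \<in> R" unfolding inv_s by (intro mult_mem s assms)
  show "fps_of_poly [:1, 0, 0, 0, 0, 0, 0, 0, 0, 0, 1/4 :: 'a:] = 1 + fps_const (4 * (1 / 16)) * fps_X ^ 10"
    by (simp add: fps_of_poly_pCons eval_nat_numeral mult.assoc)
  show "[:1, 0, -1 :: 'a:] * pCons 0 (pderiv [:1, 0, 0, 0, 0, 0, 0, 0, 0, 0, 1/4:]) =
      2 * ([:1, 0, 0, 0, 0, 0, 0, 0, 0, 0, 1/4:] * [:0, 0, -5:] + smult (s ^ 2) ([:0, 1, 0, -1, 0, 1/2:] * [:0, 1, 0, 1, 0, 1/2:]))"
    unfolding s(2) by (simp add: pderiv_pCons numeral_poly)
  show "[:1, 0, -1 :: 'a:] * pCons 0 (pderiv [:0, 1, 0, -1, 0, 1/2:]) =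
      [:0, 1, 0, -1, 0, 1/2:] * [:0, 0, -5:] + [:0, 1, 0, 1, 0, 1/2:]"
    by (simp add: pderiv_pCons)
  show "s ^ p - 1 * s \<in> pideal 1" using s(3) by simp
  fix i :: nat assume "5 < i" "i mod 2 = j mod 2"
  then have "odd i" "5 < i" using \<open>odd j\<close> by (simp_all add: odd_iff_mod_2_eq_one)
  then show "(\<Sum>k=0..5+1. coeff [:0, 1, 0, 1, 0, 1/2 :: 'a:] k * (if 2 dvd i - k then 1 else 0)) = 5/2"
    "(\<Sum>k=0..5+1. coeff [:0, 0, -5 :: 'a:] k * (if 2 dvd i - k then 1 else 0)) = 0"
    by (simp_all add: eval_nat_numeral sum.atLeast0_atMost_Suc) presburger+
qed (use assms in \<open>auto simp: one_mem fps_of_poly_pCons power2_eq_square\<close>)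

end

section \<open>Descent to the rationals\<close>

text \<open>This is Z_(p)[sqrt d] inside the reals; d = 1 gives Z_(p) itself, for the sum with s =
  1.\<close>

definition quadratic_local_ring :: "nat \<Rightarrow> nat \<Rightarrow> real set" where
  "quadratic_local_ring p d = {x. \<exists>(a :: int) (b :: int) (m :: nat). coprime m p \<and> real m * x = a + b * sqrt d}"

lemma quadratic_local_ringI:
  "coprime m p \<Longrightarrow> real m * x = of_int a + of_int b * sqrt d \<Longrightarrow> x \<in> quadratic_local_ring p d"
  unfolding quadratic_local_ring_def by blast

lemma quadratic_local_ringE:
  assumes "x \<in> quadratic_local_ring p d"
  obtains a b :: int and m :: nat where "coprime m p" "real m * x = of_int a + of_int b * sqrt d"
  using assms unfolding quadratic_local_ring_def by (elim CollectE exE conjE)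

lemma local_subring_quadratic:
  assumes "prime p"
  shows "local_subring p (quadratic_local_ring p d)"
proof
  show "1 \<in> quadratic_local_ring p d"
    by (rule quadratic_local_ringI[of 1 _ _ 1 0]) simp_all
next
  fix x y assume mem: "x \<in> quadratic_local_ring p d" "y \<in> quadratic_local_ring p d"
  obtain a b :: int and m :: nat where m: "coprime m p" and x: "real m * x = a + b * sqrt d"
    using mem(1) by (rule quadratic_local_ringE)
  obtain a' b' :: int and m' :: nat where m': "coprime m' p" and y: "real m' * y = a' + b' * sqrt d"
    using mem(2) by (rule quadratic_local_ringE)
  have mm: "coprime (m * m') p" using m m' by simp
  have "real (m * m') * (x - y) = m' * (real m * x) - m * (real m' * y)"
    by (simp add: algebra_simps)
  also have "\<dots> = of_int (m' * a - m * a') + of_int (m' * b - m * b') * sqrt d"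
    unfolding x y by (simp add: algebra_simps)
  finally show "x - y \<in> quadratic_local_ring p d"
    by (rule quadratic_local_ringI[OF mm])
  have "real (m * m') * (x * y) = (real m * x) * (real m' * y)"
    by (simp add: algebra_simps)
  also have "\<dots> = of_int (a * a' + b * b' * d) + of_int (a * b' + a' * b) * sqrt d"
    unfolding x y by (simp add: algebra_simps)
  finally show "x * y \<in> quadratic_local_ring p d"
    by (rule quadratic_local_ringI[OF mm])
qed fact

lemma sqrt_mem_quadratic: "sqrt d \<in> quadratic_local_ring p d"
  by (rule quadratic_local_ringI[of 1 _ _ 0 1]) simp_all

lemma inverse_mem_quadratic: "coprime n p \<Longrightarrow> prime p \<Longrightarrow> 1 / real n \<in> quadratic_local_ring p d"
  by (rule quadratic_local_ringI[of n _ _ 1 0]) (auto intro!: Nat.gr0I simp: field_simps)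

lemma sqrt_prime_neq_of_rat:
  assumes "prime (d :: nat)"
  shows "sqrt d \<noteq> of_rat r"
proof
  assume "sqrt d = of_rat r"
  then have "of_rat (r ^ 2) = (of_rat (of_nat d) :: real)"
    by (simp add: of_rat_power flip: \<open>sqrt d = of_rat r\<close>)
  then have r: "r ^ 2 = of_nat d" by (simp only: of_rat_eq_iff)
  obtain a b where q: "quotient_of r = (a, b)" by force
  have ab: "r = of_int a / of_int b" "b > 0" "coprime a b"
    using q quotient_of_denom_pos quotient_of_coprime quotient_of_div by blast+
  then have "(of_int a :: rat) = r * of_int b" by simp
  then have "(of_int (a ^ 2) :: rat) = of_int (int d * b ^ 2)"
    using r by (simp add: power_mult_distrib)
  then have e: "a ^ 2 = int d * b ^ 2" by (simp only: of_int_eq_iff)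
  have pd: "prime (int d)" using assms by simp
  have "int d dvd a" using e pd by (metis dvd_triv_left prime_dvd_power)
  then obtain c where c: "a = int d * c" ..
  have "int d * c ^ 2 = b ^ 2"
    using e pd by (simp add: c power2_eq_square ac_simps)
  then have "int d dvd b" using pd by (metis dvd_triv_left prime_dvd_power)
  then have "int d dvd 1" using \<open>int d dvd a\<close> ab(3) by (metis coprime_common_divisor)
  then show False using pd not_prime_unit by blast
qed

text \<open>For prime d, irrationality of sqrt d forces b = 0; for d = 1 the two coefficients add.
  Either way m r is an integer, so the reduced denominator of r divides m, which is prime to
  p.\<close>

lemma padic_integral_of_quadratic:
  assumes "of_rat r \<in> quadratic_local_ring p d" and d: "d = 1 \<or> prime d"
  shows "padic_integral p r"
proof -
  obtain a b :: int and m :: nat where m: "coprime m p" "real m * of_rat r = a + b * sqrt d"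
    using assms(1) by (rule quadratic_local_ringE)
  have "\<exists>e :: int. of_nat m * r = of_int e"
  proof (cases "d = 1")
    case True
    then have "of_rat (of_nat m * r) = (of_rat (of_int (a + b)) :: real)"
      using m(2) by (simp add: of_rat_mult of_rat_add)
    then show ?thesis by (metis of_rat_eq_iff)
  next
    case False
    have "b = 0"
    proof (rule ccontr)
      assume "b \<noteq> 0"
      then have "sqrt d = (real m * of_rat r - a) / b" using m(2) by simp
      also have "\<dots> = of_rat ((of_nat m * r - of_int a) / of_int b)"
        by (simp add: of_rat_divide of_rat_diff of_rat_mult)
      finally show False using sqrt_prime_neq_of_rat d False by blast
    qed
    then have "of_rat (of_nat m * r) = (of_rat (of_int a) :: real)"
      using m(2) by (simp add: of_rat_mult)
    then show ?thesis by (metis of_rat_eq_iff)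
  qed
  then obtain e :: int where e: "of_nat m * r = of_int e" ..
  obtain u w where uw: "quotient_of r = (u, w)" by force
  have w: "w > 0" "coprime u w" "r = of_int u / of_int w"
    using uw quotient_of_denom_pos quotient_of_coprime quotient_of_div by blast+
  have "(of_int (int m * u) :: rat) = of_int (e * w)"
    using e w by (simp add: field_simps)
  then have "int m * u = e * w" by (simp only: of_int_eq_iff)
  then have "w dvd int m * u" by simp
  then have "w dvd int m" using w(2) by (simp add: coprime_commute coprime_dvd_mult_left_iff)
  moreover have "coprime (int m) (int p)" using m(1) by simp
  ultimately have "coprime w (int p)" by (rule coprime_divisors[OF _ dvd_refl])
  then show ?thesis by (simp add: padic_integral_def uw)
qed

lemma padic_cong_of_quadratic:
  assumes p: "prime p" and d: "d = 1 \<or> prime d"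
    and x: "x \<in> local_subring.pideal p (quadratic_local_ring p d) n" "x = of_rat (a - b)"
  shows "padic_cong p n a b"
proof -
  have "of_rat ((a - b) / of_nat p ^ n) \<in> quadratic_local_ring p d"
    using x by (simp add: local_subring.pideal_def[OF local_subring_quadratic[OF p]] of_rat_divide of_rat_power)
  then have "padic_integral p ((a - b) / of_nat p ^ n)"
    using d by (rule padic_integral_of_quadratic)
  then show ?thesis using prime_gt_0_nat[OF p] unfolding padic_cong_def
    by (intro exI[of _ "(a - b) / of_nat p ^ n"]) simp
qed

text \<open>Euler's criterion applied to the p-th power of sqrt d, written as d^((p - 1) / 2) sqrt
  d. This is the source of the Legendre symbol.\<close>

lemma sqrt_power_prime:
  assumes p: "prime p" "odd p"
  shows "sqrt d ^ p - of_int (Legendre (int d) (int p)) * sqrt d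
    \<in> local_subring.pideal p (quadratic_local_ring p d) 1"
proof -
  note ring = local_subring_quadratic[OF p(1), of d]
  have "p > 2" using p prime_ge_2_nat[of p] by (cases "p = 2") auto
  then have "[Legendre (int d) (int p) = int d ^ ((p - 1) div 2)] (mod int p)"
    using euler_criterion[of p "int d"] p by simp
  then obtain k where k: "int d ^ ((p - 1) div 2) - Legendre (int d) (int p) = int p * k"
    by (metis cong_iff_dvd_diff cong_sym dvdE)
  have "p = 2 * ((p - 1) div 2) + 1" using p by (simp add: odd_two_times_div_two_nat)
  then have "sqrt d ^ p = (sqrt d ^ 2) ^ ((p - 1) div 2) * sqrt d"
    by (metis power_add power_mult power_one_right)
  then have "sqrt d ^ p - of_int (Legendre (int d) (int p)) * sqrt d =
      of_int (int d ^ ((p - 1) div 2) - Legendre (int d) (int p)) * sqrt d"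
    by (simp add: algebra_simps)
  also have "\<dots> = (of_int k * sqrt d) * of_nat p"
    unfolding k by simp
  also have "\<dots> \<in> local_subring.pideal p (quadratic_local_ring p d) 1"
    by (intro local_subring.pideal_mult_left[OF ring] local_subring.mult_mem[OF ring]
        local_subring.of_int_mem[OF ring] local_subring.pideal_p[OF ring] sqrt_mem_quadratic)
  finally show ?thesis .
qed

text \<open>The exponent in the reciprocity law is even since (5 - 1) / 2 = 2, and p is the square 1
  modulo 5.\<close>

lemma Legendre_5:
  assumes "prime p" "p mod 5 = 1" "odd p"
  shows "Legendre 5 (int p) = 1"
proof -
  have "p > 2" using assms prime_ge_2_nat[of p] by (cases "p = 2") auto
  moreover have "p \<noteq> 5" using assms by auto
  moreover have "prime (5 :: nat)" by simp
  ultimately have "Legendre (int p) (int 5) * Legendre (int 5) (int p) = (-1) ^ ((p - 1) div 2 * ((5 - 1) div 2))"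
    using assms by (intro Quadratic_Reciprocity) auto
  also have "\<dots> = 1" by simp
  also have "Legendre (int p) (int 5) = 1"
  proof -
    have c: "[int p = 1] (mod 5)" using arg_cong[OF assms(2), of int] by (simp add: cong_def zmod_int)
    then have "\<not> [int p = 0] (mod 5)" by (simp add: cong_def)
    moreover have "QuadRes 5 (int p)" unfolding QuadRes_def
      using c by (intro exI[of _ 1]) (simp add: cong_sym)
    ultimately show ?thesis by (simp add: Legendre_def)
  qed
  finally show ?thesis by simp
qed

lemma nat_floor_divide: "nat \<lfloor>of_nat m * rat_of_nat p / of_nat n\<rfloor> = p * m div n"
  using floor_divide_of_nat_eq[of "m * p" n, where 'a = rat] by (simp add: mult.commute)

lemma sum_from_1_eq:
  fixes f :: "nat \<Rightarrow> 'a::ab_group_add"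
  shows "sum f {Suc 0..n} = sum f {..n} - f 0"
proof -
  have "{..n} = insert 0 {Suc 0..n}" by auto
  then show ?thesis by simp
qed

theorem theorem1:
  fixes p :: nat
  assumes "prime p"
  shows
    "([p = 1] (mod 3) \<longrightarrow>
        padic_cong p 2 (\<Sum>k = 1..nat \<lfloor>2 * rat_of_nat p / 3\<rfloor>. of_nat ((2 * k) choose k) * (-2) ^ k) 0 \<and>
        padic_cong p 2 (\<Sum>k = 0..nat \<lfloor>5 * rat_of_nat p / 6\<rfloor>. of_nat ((2 * k) choose k) / (-32) ^ k)
          (of_int (Legendre 2 (int p)))) \<and>
     ([p = 1] (mod 5) \<longrightarrow>
        padic_cong p 2 (\<Sum>k = 1..nat \<lfloor>4 * rat_of_nat p / 5\<rfloor>. of_nat ((2 * k) choose k) * (-1) ^ k) 0 \<and>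
        padic_cong p 2 (\<Sum>k = 1..nat \<lfloor>7 * rat_of_nat p / 10\<rfloor>. of_nat ((2 * k) choose k) / (-16) ^ k) 0 \<and>
        padic_cong p 2 (\<Sum>k = 1..nat \<lfloor>3 * rat_of_nat p / 5\<rfloor>. of_nat ((2 * k) choose k) * (-1) ^ k) 0 \<and>
        padic_cong p 2 (\<Sum>k = 1..nat \<lfloor>9 * rat_of_nat p / 10\<rfloor>. of_nat ((2 * k) choose k) / (-16) ^ k) 0)"
proof (intro conjI impI)
  note ring = local_subring_quadratic[OF assms]
  have div_pow: "x / y ^ k = x * (1 / y) ^ k" for x y :: rat and k
    by (simp add: power_divide)
  have coprime: "coprime n p" if "prime n" "n \<noteq> p" for n :: nat
    using primes_coprime[OF that(1) assms that(2)] .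
  {
    assume "[p = 1] (mod 3)"
    then have p3: "p mod 3 = 1" by (simp add: cong_def)
    then have odd: "odd p" using assms prime_odd_nat[of p] prime_ge_2_nat[of p] by (cases "p = 2") auto
    have p3_neq: "p \<noteq> 3" using p3 by auto
    have inv: "1 / 2 \<in> quadratic_local_ring p d" "1 / 3 \<in> quadratic_local_ring p d" for d
      using inverse_mem_quadratic[of 2 p d] inverse_mem_quadratic[of 3 p d] coprime[of 2] coprime[of 3]
        odd p3_neq assms by auto
    \<comment> \<open>The k = 0 term is 1, so a full sum congruent to 1 leaves a sum from k = 1
      congruent to 0.\<close>
    show "padic_cong p 2 (\<Sum>k = 1..nat \<lfloor>2 * rat_of_nat p / 3\<rfloor>. of_nat ((2 * k) choose k) * (-2) ^ k) 0"
      using nat_floor_divide[of 2 p 3]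
      by (intro padic_cong_of_quadratic[OF assms _ local_subring.central_sum_pow_2[OF ring[of 1] odd inv p3]])
        (simp_all add: sum_from_1_eq of_rat_diff of_rat_sum of_rat_mult of_rat_power)
    have "[p = 1] (mod 2 * 3)"
      using p3 odd by (intro coprime_cong_mult_nat) (simp_all add: cong_def odd_iff_mod_2_eq_one)
    then have p6: "p mod 6 = 1" by (simp add: cong_def)
    \<comment> \<open>An odd p does not divide 2, so the symbol is a sign and can serve as
      \<epsilon>.\<close>
    have L: "of_int (Legendre 2 (int p)) ^ 2 = (1 :: real)"
    proof -
      have "\<not> [2 = 0] (mod int p)"
        using odd prime_ge_2_nat[OF assms] by (auto simp: cong_iff_dvd_diff dest!: zdvd_imp_le)
      then show ?thesis by (simp add: Legendre_def)
    qed
    show "padic_cong p 2 (\<Sum>k = 0..nat \<lfloor>5 * rat_of_nat p / 6\<rfloor>. of_nat ((2 * k) choose k) / (-32) ^ k)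
          (of_int (Legendre 2 (int p)))"
      using nat_floor_divide[of 5 p 6] L sqrt_power_prime[OF assms odd, of 2]
      by (intro padic_cong_of_quadratic[OF assms _ local_subring.central_sum_inverse_pow_32[OF ring[of 2] odd inv p6
            sqrt_mem_quadratic _ local_subring.of_int_mem[OF ring[of 2], of "Legendre 2 (int p)"]]])
        (simp_all add: div_pow atLeast0AtMost of_rat_diff of_rat_sum of_rat_mult of_rat_power of_rat_divide of_rat_minus
          del: power_divide power_one_over)
  }
  {
    assume "[p = 1] (mod 5)"
    then have p5: "p mod 5 = 1" by (simp add: cong_def)
    then have odd: "odd p" using assms prime_odd_nat[of p] prime_ge_2_nat[of p] by (cases "p = 2") auto
    then have "[p = 1] (mod 2 * 5)"
      using p5 by (intro coprime_cong_mult_nat) (simp_all add: cong_def odd_iff_mod_2_eq_one)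
    then have p10: "p mod 10 = 1" by (simp add: cong_def)
    have p5_neq: "p \<noteq> 5" using p5 by auto
    have inv: "1 / 2 \<in> quadratic_local_ring p 5" "1 / 5 \<in> quadratic_local_ring p 5"
      using inverse_mem_quadratic[of 2 p 5] inverse_mem_quadratic[of 5 p 5] coprime[of 2] coprime[of 5]
        odd p5_neq assms by auto
    have s: "sqrt 5 \<in> quadratic_local_ring p 5" "sqrt 5 ^ 2 = 5" "sqrt 5 ^ p - sqrt 5 \<in> local_subring.pideal p (quadratic_local_ring p 5) 1"
      using sqrt_power_prime[OF assms odd, of 5] sqrt_mem_quadratic[of 5 p] Legendre_5[OF assms p5 odd]
      by simp_all
    have five: "5 = (1 :: nat) \<or> prime (5 :: nat)" by simp
    have pow_1: "padic_cong p 2 (\<Sum>k = 1..p * j div 5. of_nat ((2 * k) choose k) * (-1) ^ k) 0"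
      if "2 < j" "j < 5" for j
      by (rule padic_cong_of_quadratic[OF assms five local_subring.central_sum_pow_1[OF ring odd inv p5 s that]])
        (simp add: sum_from_1_eq of_rat_diff of_rat_sum of_rat_mult of_rat_power of_rat_minus)
    have pow_16: "padic_cong p 2 (\<Sum>k = 1..p * j div 10. of_nat ((2 * k) choose k) / (-16) ^ k) 0"
      if "5 < j" "j < 10" "odd j" for j
      by (rule padic_cong_of_quadratic[OF assms five local_subring.central_sum_inverse_pow_16[OF ring odd inv p10 s that]])
        (simp add: div_pow sum_from_1_eq of_rat_diff of_rat_sum of_rat_mult of_rat_power of_rat_divide of_rat_minus
          del: power_divide power_one_over)
    show "padic_cong p 2 (\<Sum>k = 1..nat \<lfloor>4 * rat_of_nat p / 5\<rfloor>. of_nat ((2 * k) choose k) * (-1) ^ k) 0"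
      using pow_1[of 4] nat_floor_divide[of 4 p 5] by simp
    show "padic_cong p 2 (\<Sum>k = 1..nat \<lfloor>7 * rat_of_nat p / 10\<rfloor>. of_nat ((2 * k) choose k) / (-16) ^ k) 0"
      using pow_16[of 7] nat_floor_divide[of 7 p 10] by simp
    show "padic_cong p 2 (\<Sum>k = 1..nat \<lfloor>3 * rat_of_nat p / 5\<rfloor>. of_nat ((2 * k) choose k) * (-1) ^ k) 0"
      using pow_1[of 3] nat_floor_divide[of 3 p 5] by simp
    show "padic_cong p 2 (\<Sum>k = 1..nat \<lfloor>9 * rat_of_nat p / 10\<rfloor>. of_nat ((2 * k) choose k) / (-16) ^ k) 0"
      using pow_16[of 9] nat_floor_divide[of 9 p 10] by simp
  }
qed

end
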